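(* Let $G$ be a cyclically $4$-edge-connected cubic graph with colouring defect $\operatorname{df}(G)=3$. Then $\pi(G)=4$, unless $G$ is the Petersen graph.
   Context: Graphs may have multiple edges and loops. A connected graph $G$ is cyclically $k$-edge-connected if the removal of fewer than $k$ edges cannot leave a subgraph with at least two components containing circuits. The colouring defect $\operatorname{df}(G)$ of a bridgeless cubic graph $G$ is the minimum, over all collections $\{M_1,M_2,M_3\}$ of three (not necessarily distinct) perfect matchings of $G$, of the number of edges of $G$ belonging to none of $M_1,M_2,M_3$. The perfect matching index $\pi(G)$ is the smallest number of perfect matchings of $G$ whose union contains all edges of $G$. *)

theory Defs
  imports Main
begin

text \<open>A (multi)graph is given by a vertex set V, an edge set E and an end-point map
  ends : edge => vertex x vertex (orientation irrelevant). Parallel edges and loops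
  (ends e = (v,v)) are allowed.\<close>

definition multigraph :: "'v set \<Rightarrow> 'e set \<Rightarrow> ('e \<Rightarrow> 'v \<times> 'v) \<Rightarrow> bool" where
  "multigraph V E ends \<longleftrightarrow> finite V \<and> finite E \<and>
     (\<forall>e\<in>E. fst (ends e) \<in> V \<and> snd (ends e) \<in> V)"

text \<open>Degree of v in the spanning subgraph with edge set F (a loop counts twice).\<close>
definition deg_in :: "'e set \<Rightarrow> ('e \<Rightarrow> 'v \<times> 'v) \<Rightarrow> 'v \<Rightarrow> nat" where
  "deg_in F ends v = card {e\<in>F. fst (ends e) = v} + card {e\<in>F. snd (ends e) = v}"

definition cubic :: "'v set \<Rightarrow> 'e set \<Rightarrow> ('e \<Rightarrow> 'v \<times> 'v) \<Rightarrow> bool" where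
  "cubic V E ends \<longleftrightarrow> multigraph V E ends \<and> (\<forall>v\<in>V. deg_in E ends v = 3)"

definition adj :: "'e set \<Rightarrow> ('e \<Rightarrow> 'v \<times> 'v) \<Rightarrow> 'v \<Rightarrow> 'v \<Rightarrow> bool" where
  "adj F ends u w \<longleftrightarrow> (\<exists>e\<in>F. ends e = (u, w) \<or> ends e = (w, u))"

definition reach :: "'e set \<Rightarrow> ('e \<Rightarrow> 'v \<times> 'v) \<Rightarrow> 'v \<Rightarrow> 'v \<Rightarrow> bool" where
  "reach F ends u w \<longleftrightarrow> (adj F ends)\<^sup>*\<^sup>* u w"

definition connected_graph :: "'v set \<Rightarrow> 'e set \<Rightarrow> ('e \<Rightarrow> 'v \<times> 'v) \<Rightarrow> bool" where
  "connected_graph V E ends \<longleftrightarrow> (\<forall>u\<in>V. \<forall>w\<in>V. reach E ends u w)"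

definition bridgeless :: "'v set \<Rightarrow> 'e set \<Rightarrow> ('e \<Rightarrow> 'v \<times> 'v) \<Rightarrow> bool" where
  "bridgeless V E ends \<longleftrightarrow> (\<forall>e\<in>E. reach (E - {e}) ends (fst (ends e)) (snd (ends e)))"

definition verts_of :: "'e set \<Rightarrow> ('e \<Rightarrow> 'v \<times> 'v) \<Rightarrow> 'v set" where
  "verts_of C ends = fst ` ends ` C \<union> snd ` ends ` C"

text \<open>A circuit (cycle) contained in edge set F: a nonempty connected 2-regular
  subgraph (loops are circuits of length 1, two parallel edges of length 2).\<close>
definition circuit :: "'e set \<Rightarrow> ('e \<Rightarrow> 'v \<times> 'v) \<Rightarrow> 'e set \<Rightarrow> bool" where
  "circuit F ends C \<longleftrightarrow> C \<noteq> {} \<and> C \<subseteq> F \<and> finite C \<and>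
     (\<forall>v\<in>verts_of C ends. deg_in C ends v = 2) \<and>
     (\<forall>u\<in>verts_of C ends. \<forall>w\<in>verts_of C ends. reach C ends u w)"

definition cyc_edge_conn :: "nat \<Rightarrow> 'v set \<Rightarrow> 'e set \<Rightarrow> ('e \<Rightarrow> 'v \<times> 'v) \<Rightarrow> bool" where
  "cyc_edge_conn k V E ends \<longleftrightarrow> connected_graph V E ends \<and>
     (\<forall>F\<subseteq>E. card F < k \<longrightarrow>
        \<not> (\<exists>C1 C2 u w. circuit (E - F) ends C1 \<and> circuit (E - F) ends C2 \<and>
             u \<in> verts_of C1 ends \<and> w \<in> verts_of C2 ends \<and> \<not> reach (E - F) ends u w))"

definition perfect_matching :: "'v set \<Rightarrow> 'e set \<Rightarrow> ('e \<Rightarrow> 'v \<times> 'v) \<Rightarrow> 'e set \<Rightarrow> bool" where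
  "perfect_matching V E ends M \<longleftrightarrow> M \<subseteq> E \<and> (\<forall>v\<in>V. deg_in M ends v = 1)"

definition colouring_defect :: "'v set \<Rightarrow> 'e set \<Rightarrow> ('e \<Rightarrow> 'v \<times> 'v) \<Rightarrow> nat" where
  "colouring_defect V E ends = (LEAST n. \<exists>M1 M2 M3.
     perfect_matching V E ends M1 \<and> perfect_matching V E ends M2 \<and>
     perfect_matching V E ends M3 \<and> card (E - (M1 \<union> M2 \<union> M3)) = n)"

definition pm_index :: "'v set \<Rightarrow> 'e set \<Rightarrow> ('e \<Rightarrow> 'v \<times> 'v) \<Rightarrow> nat" where
  "pm_index V E ends = (LEAST k. \<exists>Ms. length Ms = k \<and>
     (\<forall>M\<in>set Ms. perfect_matching V E ends M) \<and> E \<subseteq> \<Union>(set Ms))"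

text \<open>The Petersen graph: vertices 0..9, edges 0..14 (outer 5-cycle, spokes,
  inner pentagram).\<close>
definition petersen_ends :: "nat \<Rightarrow> nat \<times> nat" where
  "petersen_ends e = (if e < 5 then (e, (e + 1) mod 5)
     else if e < 10 then (e - 5, e)
     else (e - 5, (e - 10 + 2) mod 5 + 5))"

definition graph_iso :: "'v set \<Rightarrow> 'e set \<Rightarrow> ('e \<Rightarrow> 'v \<times> 'v) \<Rightarrow>
    'w set \<Rightarrow> 'f set \<Rightarrow> ('f \<Rightarrow> 'w \<times> 'w) \<Rightarrow> bool" where
  "graph_iso V E ends V' E' ends' \<longleftrightarrow> (\<exists>f g. bij_betw f V V' \<and> bij_betw g E E' \<and>
     (\<forall>e\<in>E. ends' (g e) = (f (fst (ends e)), f (snd (ends e))) \<or>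
             ends' (g e) = (f (snd (ends e)), f (fst (ends e)))))"

definition is_petersen :: "'v set \<Rightarrow> 'e set \<Rightarrow> ('e \<Rightarrow> 'v \<times> 'v) \<Rightarrow> bool" where
  "is_petersen V E ends \<longleftrightarrow> graph_iso V E ends {0..<10::nat} {0..<15::nat} petersen_ends"

end

theory Submission
  imports Defs
begin

text \<open>Three perfect matchings leaving exactly three edges uncovered force a hexagon in which the
  uncovered edges U alternate with the edges covered twice. If the graph minus the hexagon has a
  perfect matching N, then U together with N is a fourth perfect matching that completes the cover.
  Otherwise Tutte's theorem provides a barrier S, and counting edges with cyclic 4-edge-connectivity
  shows that everything is tight: the graph minus the hexagon is bipartite with parts S and T,
  |T| = |S| + 2, and all six edges leaving the hexagon end in T. If two antipodal hexagon
  vertices a, d have distinct neighbours t, t' in T, Hall's theorem matches S with T - {t, t'};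
  adding the edges at, dt' and the two hexagon edges avoiding a and d gives a perfect matching
  whose complement is bipartite and 2-regular, so the graph would be 3-edge-colourable. Hence
  antipodal vertices share their third neighbour, and the graph is the Petersen graph.\<close>

section \<open>Hall and Tutte\<close>

text \<open>Tightness of the barrier comes from one comparison. By parity there are at least |S| + 2
  odd parts, and each takes at least three edges from S together with the hexagon, so at least 3|S|
  + 6 edges in all. That set has 3(|S| + 6) edge ends and spends at least 12 of them on the six
  hexagon sides, so at most 3|S| + 6 edges leave it. Cyclic connectivity enters twice more: a cut of
  exactly three edges isolates one vertex, which turns the odd parts into single vertices, and every
  nonempty part of S gets at least two more neighbours in T than it has members. That surplus of two
  is what allows t and t' to be deleted before Hall's theorem is applied. A 3-edge-colouring is
  fatal because its colour classes are three perfect matchings leaving no edge uncovered, hence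
  defect 0. The exceptional graph appears by counting: the hexagon and its three shared neighbours
  are nine vertices with at least twelve inner edges, so at most 27 - 24 = 3 edges leave them, and a
  single vertex is missing.\<close>

theorem hall_marriage:
  assumes "finite A" and "\<And>a. a \<in> A \<Longrightarrow> finite (N a)"
    and "\<And>X. X \<subseteq> A \<Longrightarrow> card X \<le> card (\<Union>(N ` X))"
  shows "\<exists>f. inj_on f A \<and> (\<forall>a\<in>A. f a \<in> N a)"
  using assms
proof (induction "card A" arbitrary: A N rule: less_induct)
  case less
  note finA = less.prems(1) and finN = less.prems(2) and hall = less.prems(3)
  show ?case
  proof (cases "A = {}")
    case False
    then obtain a where a: "a \<in> A" by blast
    show ?thesis
    \<comment> \<open>Halmos-Vaughan dichotomy: a tight proper subset splits the problem into two
      independent ones; without one, every nonempty proper subset has a spare neighbour, so any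
      single pair may be removed.\<close>
    proof (cases "\<exists>X. X \<subset> A \<and> X \<noteq> {} \<and> card (\<Union>(N ` X)) = card X")
      case True
      then obtain X where X: "X \<subset> A" "X \<noteq> {}" "card (\<Union>(N ` X)) = card X" by blast
      define Y where "Y = \<Union>(N ` X)"
      have finX: "finite X" using X(1) finA finite_subset by auto
      have finY: "finite Y" unfolding Y_def using finX X(1) finN by auto
      have "card X < card A" using X(1) finA psubset_card_mono by blast
      then have "\<exists>f. inj_on f X \<and> (\<forall>a\<in>X. f a \<in> N a)"
        using less.hyps[of X N] finX X(1) finN hall by (metis psubset_imp_subset subset_eq)
      then obtain f where f: "inj_on f X" "\<forall>a\<in>X. f a \<in> N a" by blast
      have "card (A - X) < card A"
        using X(1,2) finA by (intro psubset_card_mono) auto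
      \<comment> \<open>Hall's condition for \<open>Z \<union> X\<close>, reduced by the tight
        equality for \<open>X\<close>.\<close>
      moreover have "card Z \<le> card (\<Union>((\<lambda>a. N a - Y) ` Z))" if Z: "Z \<subseteq> A - X" for Z
      proof -
        have finZ: "finite Z" using Z finA finite_subset by blast
        have "card Z + card X = card (Z \<union> X)"
          using Z finX finZ by (subst card_Un_disjoint) auto
        also have "\<dots> \<le> card (\<Union>(N ` (Z \<union> X)))" using hall[of "Z \<union> X"] Z X(1) by auto
        also have "\<Union>(N ` (Z \<union> X)) = (\<Union>((\<lambda>a. N a - Y) ` Z)) \<union> Y" unfolding Y_def by auto
        also have "card \<dots> \<le> card (\<Union>((\<lambda>a. N a - Y) ` Z)) + card Y" by (rule card_Un_le)
        finally show ?thesis using X(3) Y_def by simp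
      qed
      ultimately have "\<exists>g. inj_on g (A - X) \<and> (\<forall>a\<in>A - X. g a \<in> N a - Y)"
        using less.hyps[of "A - X" "\<lambda>a. N a - Y"] finA finN by auto
      then obtain g where g: "inj_on g (A - X)" "\<forall>a\<in>A - X. g a \<in> N a - Y" by blast
      have fY: "f x \<in> Y" if "x \<in> X" for x using f(2) that Y_def by auto
      let ?h = "\<lambda>x. if x \<in> X then f x else g x"
      have "inj_on ?h A"
      proof (rule inj_onI)
        fix x y assume xy: "x \<in> A" "y \<in> A" "?h x = ?h y"
        show "x = y"
        proof (cases "x \<in> X"; cases "y \<in> X")
          assume "x \<in> X" "y \<in> X"
          then show ?thesis using f(1) xy(3) by (auto dest: inj_onD)
        next
          assume "x \<in> X" "y \<notin> X"
          then show ?thesis using g(2) xy fY[of x] by force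
        next
          assume "x \<notin> X" "y \<in> X"
          then show ?thesis using g(2) xy fY[of y] by force
        next
          assume "x \<notin> X" "y \<notin> X"
          then show ?thesis using g(1) xy by (auto dest: inj_onD)
        qed
      qed
      moreover have "\<forall>a\<in>A. ?h a \<in> N a" using f(2) g(2) by auto
      ultimately show ?thesis by (intro exI[of _ ?h]) blast
    next
      case False
      have "card {a} \<le> card (\<Union>(N ` {a}))" using hall[of "{a}"] a by blast
      then obtain b where b: "b \<in> N a" by (cases "N a = {}") auto
      have "card (A - {a}) < card A" using a finA by (meson card_Diff1_less)
      moreover have "card Z \<le> card (\<Union>((\<lambda>x. N x - {b}) ` Z))" if Z: "Z \<subseteq> A - {a}" for Z
      proof (cases "Z = {}")
        case nonempty: False
        have "Z \<subset> A" using Z a by blast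
        then have "card Z < card (\<Union>(N ` Z))"
          using False nonempty hall[of Z] by (metis le_neq_implies_less psubset_imp_subset)
        moreover have "card (\<Union>(N ` Z)) - 1 \<le> card (\<Union>(N ` Z) - {b})"
          by (simp add: card_Diff_singleton_if)
        moreover have "card (\<Union>(N ` Z) - {b}) = card (\<Union>((\<lambda>x. N x - {b}) ` Z))"
          by (rule arg_cong[where f = card]) auto
        ultimately show ?thesis by linarith
      qed simp
      ultimately have "\<exists>g. inj_on g (A - {a}) \<and> (\<forall>x\<in>A - {a}. g x \<in> N x - {b})"
        using less.hyps[of "A - {a}" "\<lambda>x. N x - {b}"] finA finN by auto
      then obtain g where g: "inj_on g (A - {a})" "\<forall>x\<in>A - {a}. g x \<in> N x - {b}" by blast
      have "inj_on (g(a := b)) A"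
        using g by (intro inj_onI) (auto split: if_splits dest: inj_onD)
      moreover have "\<forall>x\<in>A. (g(a := b)) x \<in> N x" using g(2) b by auto
      ultimately show ?thesis by blast
    qed
  qed (simp add: exI[of _ undefined])
qed

text \<open>Stated for a relation rather than for edges, so that Tutte's theorem never sees parallel
  edges; actual edges are chosen in \<open>pairing_edges\<close>.\<close>

definition pairing :: "('v \<Rightarrow> 'v \<Rightarrow> bool) \<Rightarrow> 'v set \<Rightarrow> 'v set set \<Rightarrow> bool" where
  "pairing R W N \<longleftrightarrow> pairwise disjnt N \<and> \<Union>N = W \<and> (\<forall>p\<in>N. \<exists>x y. p = {x, y} \<and> x \<noteq> y \<and> R x y)"

text \<open>The members of \<open>\<F>\<close> need not be connected: any odd union of components of
  \<open>W - S\<close> is allowed, so no theory of components is needed.\<close>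

definition barrier :: "('v \<Rightarrow> 'v \<Rightarrow> bool) \<Rightarrow> 'v set \<Rightarrow> 'v set \<Rightarrow> 'v set set \<Rightarrow> bool" where
  "barrier R W S \<F> \<longleftrightarrow> S \<subseteq> W \<and> pairwise disjnt \<F> \<and>
     (\<forall>X\<in>\<F>. X \<subseteq> W - S \<and> odd (card X) \<and> (\<forall>x\<in>X. \<forall>y\<in>W - S - X. \<not> R x y))"

lemma pairing_pair: "x \<noteq> y \<Longrightarrow> R x y \<Longrightarrow> pairing R {x, y} {{x, y}}"
  unfolding pairing_def by auto

lemma pairing_UN:
  assumes "\<And>i. i \<in> I \<Longrightarrow> pairing R (A i) (N i)"
    and "\<And>i j. i \<in> I \<Longrightarrow> j \<in> I \<Longrightarrow> i \<noteq> j \<Longrightarrow> A i \<inter> A j = {}"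
  shows "pairing R (\<Union>i\<in>I. A i) (\<Union>i\<in>I. N i)"
proof -
  have sub: "p \<subseteq> A i" if "i \<in> I" "p \<in> N i" for i p
    using assms(1)[OF that(1)] that(2) unfolding pairing_def by blast
  have "disjnt p q" if "i \<in> I" "j \<in> I" "p \<in> N i" "q \<in> N j" "p \<noteq> q" for i j p q
  proof (cases "i = j")
    case True
    then show ?thesis using assms(1)[OF that(1)] that unfolding pairing_def pairwise_def by blast
  next
    case False
    then show ?thesis using assms(2)[OF that(1,2)] sub that unfolding disjnt_def by blast
  qed
  then have "pairwise disjnt (\<Union>i\<in>I. N i)" unfolding pairwise_def by blast
  moreover have "\<Union>(\<Union>i\<in>I. N i) = (\<Union>i\<in>I. A i)"
  proof -
    have "\<Union>(\<Union>i\<in>I. N i) = (\<Union>i\<in>I. \<Union>(N i))" by blast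
    also have "\<dots> = (\<Union>i\<in>I. A i)"
      using assms(1) by (intro SUP_cong) (simp_all add: pairing_def)
    finally show ?thesis .
  qed
  moreover have "\<forall>p\<in>(\<Union>i\<in>I. N i). \<exists>x y. p = {x, y} \<and> x \<noteq> y \<and> R x y"
    using assms(1) unfolding pairing_def by blast
  ultimately show ?thesis unfolding pairing_def by blast
qed

lemma pairing_Un:
  assumes "pairing R A N" "pairing R B N'" "A \<inter> B = {}"
  shows "pairing R (A \<union> B) (N \<union> N')"
proof -
  have "pairing R (\<Union>b\<in>UNIV. if b then A else B) (\<Union>b\<in>UNIV. if b then N else N')"
    by (rule pairing_UN) (use assms in \<open>auto split: if_splits\<close>)
  then show ?thesis by (simp add: UNIV_bool Un_commute)
qed

lemma pairing_inj:
  assumes "inj_on f A" "\<And>x. x \<in> A \<Longrightarrow> R x (f x)" "A \<inter> f ` A = {}"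
  shows "\<exists>N. pairing R (A \<union> f ` A) N"
proof -
  have "pairing R (\<Union>x\<in>A. {x, f x}) (\<Union>x\<in>A. {{x, f x}})"
    using assms by (intro pairing_UN pairing_pair) (auto dest: inj_onD)
  moreover have "(\<Union>x\<in>A. {x, f x}) = A \<union> f ` A" by auto
  ultimately show ?thesis by auto
qed

section \<open>Parity of barriers\<close>

lemma barrier_disjoint: "barrier R W S \<F> \<Longrightarrow> X \<in> \<F> \<Longrightarrow> Y \<in> \<F> \<Longrightarrow> X \<noteq> Y \<Longrightarrow> X \<inter> Y = {}"
  by (simp add: barrier_def pairwise_def disjnt_def)

lemma barrier_finite: "finite W \<Longrightarrow> barrier R W S \<F> \<Longrightarrow> finite \<F>"
  unfolding barrier_def by (rule finite_subset[of _ "Pow W"]) auto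

lemma barrier_card:
  assumes "finite W" "barrier R W S \<F>"
  shows "even (card W) \<longleftrightarrow> even (card S + card \<F> + card (W - S - \<Union>\<F>))"
proof -
  have S: "S \<subseteq> W" and sub: "\<Union>\<F> \<subseteq> W - S" and odds: "\<forall>X\<in>\<F>. odd (card X)"
    and dis: "pairwise disjnt \<F>"
    using assms(2) unfolding barrier_def by blast+
  have fin: "finite \<F>" using barrier_finite assms by blast
  have finU: "finite (\<Union>\<F>)" using sub assms(1) finite_subset by blast
  have "card (\<Union>\<F>) = (\<Sum>X\<in>\<F>. card X)"
    using dis odds by (intro card_Union_disjoint) (auto intro: card_ge_0_finite simp: odd_pos)
  moreover have "even (\<Sum>X\<in>\<F>. card X) \<longleftrightarrow> even (card \<F>)"
    using fin odds by (induction rule: finite_induct) auto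
  moreover have "card W = card S + (card (\<Union>\<F>) + card (W - S - \<Union>\<F>))"
    using S sub assms(1) finU finite_subset[OF S assms(1)]
    by (metis card_Diff_subset card_mono finite_Diff le_add_diff_inverse)
  ultimately show ?thesis by auto
qed

text \<open>No member is related to the leftover vertices, so by symmetry the leftover set is itself
  closed; if odd, it qualifies as one more member.\<close>

lemma barrier_insert_rest:
  assumes "symp R" "barrier R W S \<F>" "odd (card (W - S - \<Union>\<F>))"
  shows "barrier R W S (insert (W - S - \<Union>\<F>) \<F>)" "W - S - \<Union>\<F> \<notin> \<F>"
proof -
  let ?Y = "W - S - \<Union>\<F>"
  have "\<not> R y x" if "y \<in> ?Y" "x \<in> W - S - ?Y" for x y
  proof -
    from that obtain X where "X \<in> \<F>" "x \<in> X" by blast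
    then have "\<not> R x y" using assms(2) that unfolding barrier_def by blast
    then show ?thesis using assms(1) by (meson sympD)
  qed
  moreover have "pairwise disjnt (insert ?Y \<F>)"
    using assms(2) unfolding barrier_def pairwise_insert disjnt_def by blast
  ultimately show "barrier R W S (insert ?Y \<F>)"
    using assms(2,3) unfolding barrier_def by blast
  have "?Y \<noteq> {}" using assms(3) by (metis card.empty even_zero)
  then show "?Y \<notin> \<F>" by blast
qed

text \<open>With an even rest, \<open>card S\<close> and \<open>card \<F>\<close> have the same
  parity, so a strict excess is at least 2; an odd rest supplies the missing member.\<close>

lemma barrier_parity:
  assumes "finite W" "symp R" "even (card W)" "barrier R W S \<F>" "card S < card \<F>"
  shows "\<exists>\<F>'. barrier R W S \<F>' \<and> card S + 2 \<le> card \<F>'"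
proof (cases "even (card (W - S - \<Union>\<F>))")
  case True
  then have "even (card S + card \<F>)" using barrier_card assms by fastforce
  then have "card \<F> \<noteq> card S + 1" by auto
  then show ?thesis using assms(4,5) by (intro exI[of _ \<F>]) linarith
next
  case False
  have "card (insert (W - S - \<Union>\<F>) \<F>) = card \<F> + 1"
    using barrier_insert_rest(2)[OF assms(2,4) False] barrier_finite[OF assms(1,4)] by simp
  then show ?thesis using barrier_insert_rest(1)[OF assms(2,4) False] assms(5)
    by (intro exI[of _ "insert (W - S - \<Union>\<F>) \<F>"] conjI) linarith+
qed

text \<open>A barrier with \<open>card \<F> = card S\<close> and \<open>card S\<close> maximal leaves no other vertices, each of its
  members minus any vertex is matchable by induction, and Hall's condition for matching \<open>\<F>\<close> into
  \<open>S\<close> is the barrier inequality itself.\<close>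

theorem tutte:
  assumes "finite W" "symp R"
  shows "(\<exists>N. pairing R W N) \<or> (\<exists>S \<F>. barrier R W S \<F> \<and> card S < card \<F>)"
  using assms(1)
proof (induction "card W" arbitrary: W rule: less_induct)
  case less
  note finW = less.prems
  show ?case
  proof (rule disjCI)
    assume "\<not> (\<exists>S \<F>. barrier R W S \<F> \<and> card S < card \<F>)"
    then have small: "card \<F> \<le> card S" if "barrier R W S \<F>" for S \<F> using that by force
    have evenW: "even (card W)"
    proof (rule ccontr)
      assume "odd (card W)"
      then have "barrier R W {} {W}" unfolding barrier_def by auto
      then show False using small by fastforce
    qed
    let ?P = "\<lambda>(S, \<F>). barrier R W S \<F> \<and> card \<F> = card S"
    \<comment> \<open>Only barriers with equality compete. The empty one is among them and
      \<open>card S\<close> is bounded, so a maximum exists.\<close>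
    have "\<exists>x. ?P x \<and> (\<forall>y. ?P y \<longrightarrow> card (fst y) \<le> card (fst x))"
    proof (rule Lattices_Big.ex_has_greatest_nat[of ?P "({}, {})" "\<lambda>x. card (fst x)" "Suc (card W)"])
      show "?P ({}, {})" unfolding barrier_def by auto
      show "\<forall>y. ?P y \<longrightarrow> card (fst y) < Suc (card W)"
        using finW by (auto simp: barrier_def less_Suc_eq_le intro: card_mono)
    qed
    then obtain S \<F> where bar: "barrier R W S \<F>" and eq: "card \<F> = card S"
      and "\<forall>y. ?P y \<longrightarrow> card (fst y) \<le> card S" by auto
    then have maxi: "card S' \<le> card S" if "barrier R W S' \<F>'" "card \<F>' = card S'" for S' \<F>'
      using that by (metis (mono_tags, lifting) case_prodI fst_conv)
    have fin: "finite \<F>" using barrier_finite finW bar by blast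
    have SW: "S \<subseteq> W" and dis: "pairwise disjnt \<F>" using bar unfolding barrier_def by blast+
    have finS: "finite S" using SW finW finite_subset by blast
    have \<F>: "X \<subseteq> W - S" "odd (card X)" "\<And>x y. x \<in> X \<Longrightarrow> y \<in> W - S - X \<Longrightarrow> \<not> R x y"
      if "X \<in> \<F>" for X
      using bar that unfolding barrier_def by blast+
    have finX: "finite X" if "X \<in> \<F>" for X using \<F>(1)[OF that] finW finite_subset by blast
    define Y where "Y = W - S - \<Union>\<F>"
    \<comment> \<open>The rest is even; moving one of its vertices into \<open>S\<close> turns what
      remains into an odd member, and equality persists with a larger \<open>S\<close>.\<close>
    have rest: "Y = {}"
    proof (rule ccontr)
      assume "Y \<noteq> {}"
      then obtain v where v: "v \<in> Y" by blast
      have "even (card Y)" using barrier_card[OF finW bar] evenW eq unfolding Y_def by simp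
      moreover have "finite Y" using finW Y_def by blast
      ultimately have oddY: "odd (card (Y - {v}))" using v card_Suc_Diff1[of Y v] by (metis even_Suc)
      have b: "barrier R W (insert v S) \<F>" using bar v unfolding barrier_def Y_def by blast
      have Yv: "Y - {v} = W - insert v S - \<Union>\<F>" unfolding Y_def by blast
      note new = barrier_insert_rest[OF assms(2) b oddY[unfolded Yv]]
      have "card (insert (W - insert v S - \<Union>\<F>) \<F>) = card (insert v S)"
        using new(2) fin finS v eq unfolding Y_def by simp
      from maxi[OF new(1) this] show False using v finS unfolding Y_def by simp
    qed
    have crit: "\<exists>N. pairing R (K - {v}) N" if K: "K \<in> \<F>" and v: "v \<in> K" for K v
    proof (rule ccontr)
      assume none: "\<not> ?thesis"
      have "K - {v} \<subset> W" using \<F>(1)[OF K] v by blast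
      then have "card (K - {v}) < card W" using finW psubset_card_mono by blast
      then obtain S' \<G> where "barrier R (K - {v}) S' \<G>" "card S' < card \<G>"
        using less.hyps none finX[OF K] by blast
      moreover have "even (card (K - {v}))" using \<F>(2)[OF K] v finX[OF K] by simp
      ultimately obtain \<G>' where G: "barrier R (K - {v}) S' \<G>'" "card S' + 2 \<le> card \<G>'"
        using barrier_parity[of "K - {v}" R S' \<G>] assms(2) finX[OF K] by auto
      have finG: "finite \<G>'" using G(1) barrier_finite finX[OF K] by blast
      have S'K: "S' \<subseteq> K - {v}" and subG: "\<And>X. X \<in> \<G>' \<Longrightarrow> X \<subseteq> K - {v} - S'"
        and oddG: "\<And>X. X \<in> \<G>' \<Longrightarrow> odd (card X)" and disG: "pairwise disjnt \<G>'"
        and closedG: "\<And>X x y. X \<in> \<G>' \<Longrightarrow> x \<in> X \<Longrightarrow> y \<in> K - {v} - S' - X \<Longrightarrow> \<not> R x y"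
        using G(1) unfolding barrier_def by blast+
      \<comment> \<open>Replacing \<open>K\<close> by the members of \<open>\<G>'\<close> loses one
        part and adds \<open>v\<close> to \<open>S\<close>. The surplus of 2 in
        \<open>K - {v}\<close> pays for both, so equality persists with a larger
        \<open>S\<close>.\<close>
      let ?S = "insert v (S \<union> S')" and ?F = "(\<F> - {K}) \<union> \<G>'"
      have KX: "X \<inter> K = {}" if "X \<in> \<F> - {K}" for X
        using dis that K unfolding pairwise_def disjnt_def by blast
      have "barrier R W ?S ?F"
        unfolding barrier_def
      proof (intro conjI ballI)
        show "?S \<subseteq> W" using SW S'K \<F>(1)[OF K] v by blast
        show "pairwise disjnt ?F"
          unfolding pairwise_def disjnt_def
        proof (intro ballI impI)
          fix X Z assume XZ: "X \<in> ?F" "Z \<in> ?F" "X \<noteq> Z"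
          have "X \<inter> Z = {}" if "X \<in> \<F>" "Z \<in> \<F>" using dis that XZ(3) unfolding pairwise_def disjnt_def by blast
          moreover have "X \<inter> Z = {}" if "X \<in> \<G>'" "Z \<in> \<G>'" using disG that XZ(3) unfolding pairwise_def disjnt_def by blast
          moreover have "X \<inter> Z = {}" if "X \<in> \<F> - {K}" "Z \<in> \<G>'" using KX that subG by blast
          moreover have "X \<inter> Z = {}" if "X \<in> \<G>'" "Z \<in> \<F> - {K}" using KX that subG by blast
          ultimately show "X \<inter> Z = {}" using XZ by blast
        qed
        fix X assume X: "X \<in> ?F"
        show "X \<subseteq> W - ?S"
        proof (cases "X \<in> \<G>'")
          case True
          then show ?thesis using subG[OF True] \<F>(1)[OF K] by blast
        next
          case False
          then show ?thesis using X KX[of X] \<F>(1)[of X] S'K v by blast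
        qed
        show "odd (card X)" using X \<F>(2) oddG by blast
        fix x y assume xy: "x \<in> X" "y \<in> W - ?S - X"
        show "\<not> R x y"
        proof (cases "X \<in> \<G>'")
          case True
          then show ?thesis using closedG[OF True xy(1), of y] \<F>(3)[OF K, of x y] subG[OF True] xy by blast
        next
          case False
          then show ?thesis using \<F>(3)[of X x y] X xy by blast
        qed
      qed
      note new = this
      have "(\<F> - {K}) \<inter> \<G>' = {}"
      proof (rule equals0I)
        fix X assume X: "X \<in> (\<F> - {K}) \<inter> \<G>'"
        then have "X = {}" using KX[of X] subG[of X] by blast
        then show False using oddG X by fastforce
      qed
      then have cF: "card ?F = card \<F> - 1 + card \<G>'"
        using fin finG K by (simp add: card_Un_disjoint)
      have vS: "v \<notin> S \<union> S'" "S \<inter> S' = {}" using \<F>(1)[OF K] v S'K by blast+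
      have finS': "finite S'" using S'K finX[OF K] finite_subset by blast
      have cS: "card ?S = card S + card S' + 1"
        using vS finS finS' by (simp add: card_Un_disjoint)
      have "card \<F> > 0" using fin K card_gt_0_iff by blast
      then have "card ?F = card ?S" using small[OF new] cF cS G(2) eq by linarith
      from maxi[OF new this] show False using cS by linarith
    qed
    define nb where "nb K = {s \<in> S. \<exists>x\<in>K. R x s}" for K
    have "\<exists>g. inj_on g \<F> \<and> (\<forall>K\<in>\<F>. g K \<in> nb K)"
    proof (rule hall_marriage[OF fin])
      show "finite (nb K)" for K using finS unfolding nb_def by simp
      fix X assume X: "X \<subseteq> \<F>"
      \<comment> \<open>Vertices of \<open>S\<close> with no neighbour in the members of
        \<open>X\<close> now fall among the leftovers, which a barrier may have.\<close>
      have "barrier R W (\<Union>(nb ` X)) X"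
        unfolding barrier_def
      proof (intro conjI ballI)
        show "\<Union>(nb ` X) \<subseteq> W" using SW unfolding nb_def by blast
        show "pairwise disjnt X" using dis X pairwise_subset by blast
        fix K assume K: "K \<in> X"
        show "K \<subseteq> W - \<Union>(nb ` X)" using \<F>(1) K X unfolding nb_def by blast
        show "odd (card K)" using \<F>(2) K X by blast
        fix x y assume "x \<in> K" "y \<in> W - \<Union>(nb ` X) - K"
        then show "\<not> R x y" using \<F>(3)[of K x y] K X unfolding nb_def by blast
      qed
      then show "card X \<le> card (\<Union>(nb ` X))" by (rule small)
    qed
    then obtain g where g: "inj_on g \<F>" "\<forall>K\<in>\<F>. g K \<in> nb K" by blast
    have "g ` \<F> \<subseteq> S" using g(2) unfolding nb_def by blast
    then have gF: "g ` \<F> = S" using g(1) eq finS by (simp add: card_image card_subset_eq)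
    have "\<exists>N. pairing R (insert (g K) K) N" if K: "K \<in> \<F>" for K
    proof -
      obtain x where x: "x \<in> K" "R x (g K)" using g(2) K unfolding nb_def by blast
      obtain N where N: "pairing R (K - {x}) N" using crit[OF K x(1)] by blast
      have gK: "g K \<notin> K" using gF K \<F>(1)[OF K] by blast
      have "pairing R ({x, g K} \<union> (K - {x})) ({{x, g K}} \<union> N)"
        using gK x by (intro pairing_Un N pairing_pair) auto
      moreover have "{x, g K} \<union> (K - {x}) = insert (g K) K" using x by blast
      ultimately show ?thesis by auto
    qed
    then obtain N where N: "\<And>K. K \<in> \<F> \<Longrightarrow> pairing R (insert (g K) K) (N K)" by metis
    have "pairing R (\<Union>K\<in>\<F>. insert (g K) K) (\<Union>K\<in>\<F>. N K)"
    proof (rule pairing_UN[OF N])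
      fix K L assume KL: "K \<in> \<F>" "L \<in> \<F>" "K \<noteq> L"
      have "K \<inter> L = {}" using dis KL unfolding pairwise_def disjnt_def by blast
      moreover have "g K \<noteq> g L" using g(1) KL by (meson inj_onD)
      moreover have "g K \<notin> L" "g L \<notin> K" using gF KL \<F>(1) by blast+
      ultimately show "insert (g K) K \<inter> insert (g L) L = {}" by blast
    qed
    moreover have "(\<Union>K\<in>\<F>. insert (g K) K) = W"
      using gF rest SW \<F>(1) unfolding Y_def by blast
    ultimately show "\<exists>N. pairing R W N" by blast
  qed
qed

section \<open>Multigraphs\<close>

definition endset :: "('e \<Rightarrow> 'v \<times> 'v) \<Rightarrow> 'e \<Rightarrow> 'v set" where
  "endset ends e = {fst (ends e), snd (ends e)}"

definition edge_cut :: "'e set \<Rightarrow> ('e \<Rightarrow> 'v \<times> 'v) \<Rightarrow> 'v set \<Rightarrow> 'e set" where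
  "edge_cut F ends X = {e\<in>F. (fst (ends e) \<in> X) \<noteq> (snd (ends e) \<in> X)}"

definition edges_inside :: "'e set \<Rightarrow> ('e \<Rightarrow> 'v \<times> 'v) \<Rightarrow> 'v set \<Rightarrow> 'e set" where
  "edges_inside F ends X = {e\<in>F. endset ends e \<subseteq> X}"

lemma adj_iff_endset: "adj F ends u w \<longleftrightarrow> (\<exists>e\<in>F. endset ends e = {u, w})"
  unfolding adj_def endset_def by (auto simp: doubleton_eq_iff prod_eq_iff)

lemma symp_adj: "symp (adj F ends)"
  unfolding adj_def symp_def by blast

lemma verts_of_endset: "verts_of F ends = (\<Union>e\<in>F. endset ends e)"
  unfolding verts_of_def endset_def by auto

lemma finite_endset [simp]: "finite (endset ends e)" and endset_nonempty [simp]: "endset ends e \<noteq> {}"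
  unfolding endset_def by auto

lemma handshake:
  assumes "finite F" "finite X"
  shows "(\<Sum>v\<in>X. deg_in F ends v) = card (edge_cut F ends X) + 2 * card (edges_inside F ends X)"
proof -
  \<comment> \<open>\<open>deg_in\<close> counts first and second ends separately: an edge inside
    \<open>X\<close>, loops included, lies in both sets, and a cut edge in exactly one.\<close>
  let ?A = "{e\<in>F. fst (ends e) \<in> X}" and ?B = "{e\<in>F. snd (ends e) \<in> X}"
  have count: "(\<Sum>v\<in>X. card {e\<in>F. p e = v}) = card {e\<in>F. p e \<in> X}" for p :: "'a \<Rightarrow> 'b"
  proof -
    have "{e\<in>F. p e \<in> X} = (\<Union>v\<in>X. {e\<in>F. p e = v})" by auto
    also have "card \<dots> = (\<Sum>v\<in>X. card {e\<in>F. p e = v})"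
      using assms by (intro card_UN_disjoint) auto
    finally show ?thesis by simp
  qed
  have "(\<Sum>v\<in>X. deg_in F ends v) = card ?A + card ?B"
    unfolding deg_in_def sum.distrib using count[of "\<lambda>e. fst (ends e)"] count[of "\<lambda>e. snd (ends e)"] by simp
  also have "\<dots> = card (?A \<union> ?B) + card (?A \<inter> ?B)" using assms(1) by (intro card_Un_Int) auto
  also have "?A \<inter> ?B = edges_inside F ends X" unfolding edges_inside_def endset_def by auto
  also have "?A \<union> ?B = edge_cut F ends X \<union> edges_inside F ends X"
    unfolding edges_inside_def edge_cut_def endset_def by auto
  also have "card \<dots> = card (edge_cut F ends X) + card (edges_inside F ends X)"
    using assms(1) by (intro card_Un_disjoint) (auto simp: edges_inside_def edge_cut_def endset_def)
  finally show ?thesis by simp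
qed

lemma deg_in_card:
  assumes "\<forall>e\<in>F. fst (ends e) \<noteq> snd (ends e)" "finite F"
  shows "deg_in F ends v = card {e\<in>F. v \<in> endset ends e}"
proof -
  have "{e\<in>F. v \<in> endset ends e} = {e\<in>F. fst (ends e) = v} \<union> {e\<in>F. snd (ends e) = v}"
    unfolding endset_def by auto
  also have "card \<dots> = deg_in F ends v"
    unfolding deg_in_def using assms by (intro card_Un_disjoint) auto
  finally show ?thesis by simp
qed

lemma deg_in_Un:
  assumes "finite F" "finite F'" "F \<inter> F' = {}"
  shows "deg_in (F \<union> F') ends v = deg_in F ends v + deg_in F' ends v"
proof -
  have "card {e \<in> F \<union> F'. Q e} = card {e\<in>F. Q e} + card {e\<in>F'. Q e}" for Q
  proof -
    have "{e \<in> F \<union> F'. Q e} = {e\<in>F. Q e} \<union> {e\<in>F'. Q e}" by blast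
    then show ?thesis using assms by (simp add: card_Un_disjoint disjoint_iff)
  qed
  then show ?thesis unfolding deg_in_def by simp
qed

lemma deg_in_eq_0: "(\<And>e. e \<in> F \<Longrightarrow> v \<notin> endset ends e) \<Longrightarrow> deg_in F ends v = 0"
  unfolding deg_in_def endset_def by (simp add: card_eq_0_iff) blast

lemma deg_in_Un_eq_1:
  assumes "finite M" "finite M'" "A \<inter> B = {}"
    and "\<And>e. e \<in> M \<Longrightarrow> endset ends e \<subseteq> A" "\<And>e. e \<in> M' \<Longrightarrow> endset ends e \<subseteq> B"
    and "\<And>v. v \<in> A \<Longrightarrow> deg_in M ends v = 1" "\<And>v. v \<in> B \<Longrightarrow> deg_in M' ends v = 1"
    and "v \<in> A \<union> B"
  shows "deg_in (M \<union> M') ends v = 1"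
proof -
  have "M \<inter> M' = {}"
  proof (rule equals0I)
    fix e assume "e \<in> M \<inter> M'"
    then have "endset ends e \<subseteq> A \<inter> B" using assms(4,5) by blast
    then show False using assms(3) by simp
  qed
  then have "deg_in (M \<union> M') ends v = deg_in M ends v + deg_in M' ends v"
    using assms by (intro deg_in_Un)
  moreover have "deg_in M ends v = 0" if "v \<notin> A" using assms(4) that by (intro deg_in_eq_0) blast
  moreover have "deg_in M' ends v = 0" if "v \<notin> B" using assms(5) that by (intro deg_in_eq_0) blast
  ultimately show ?thesis using assms(3,6,7,8) by fastforce
qed

section \<open>Matchings and circuits in multigraphs\<close>

lemma pairing_edges:
  assumes "finite F" "pairing (adj F ends) W N"
  shows "\<exists>M\<subseteq>F. (\<forall>e\<in>M. endset ends e \<subseteq> W) \<and> (\<forall>v\<in>W. deg_in M ends v = 1)"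
proof -
  have "\<exists>e. e \<in> F \<and> endset ends e = p" if "p \<in> N" for p
    using assms(2) that unfolding pairing_def adj_iff_endset by metis
  then obtain pick where pick: "\<And>p. p \<in> N \<Longrightarrow> pick p \<in> F \<and> endset ends (pick p) = p" by metis
  have UN: "\<Union>N = W" using assms(2) by (simp add: pairing_def)
  let ?M = "pick ` N"
  have finM: "finite ?M" using pick assms(1) by (meson finite_subset image_subsetI)
  have loopfree: "\<forall>e\<in>?M. fst (ends e) \<noteq> snd (ends e)"
  proof
    fix e assume "e \<in> ?M"
    then obtain p where p: "p \<in> N" "e = pick p" by blast
    then obtain x y where "endset ends e = {x, y}" "x \<noteq> y"
      using assms(2) pick unfolding pairing_def by metis
    then show "fst (ends e) \<noteq> snd (ends e)" unfolding endset_def by auto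
  qed
  have "deg_in ?M ends v = 1" if v: "v \<in> W" for v
  proof -
    obtain p where p: "p \<in> N" "v \<in> p" using v UN by blast
    have "pairwise disjnt N" using assms(2) by (simp add: pairing_def)
    then have uniq: "q = p" if "q \<in> N" "v \<in> q" for q
      using that p pairwiseD[of disjnt N q p] unfolding disjnt_def by blast
    have "e = pick p" if e: "e \<in> ?M" "v \<in> endset ends e" for e
    proof -
      from e(1) obtain q where q: "q \<in> N" "e = pick q" by blast
      then have "v \<in> q" using e(2) pick by metis
      then show ?thesis using uniq[OF q(1)] q(2) by simp
    qed
    moreover have "pick p \<in> ?M" "v \<in> endset ends (pick p)" using pick[OF p(1)] p by auto
    ultimately have "{e\<in>?M. v \<in> endset ends e} = {pick p}" by blast
    then show ?thesis using deg_in_card[OF loopfree finM, of v] by simp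
  qed
  moreover have "endset ends e \<subseteq> W" if "e \<in> ?M" for e
    using UN pick that by auto
  moreover have "?M \<subseteq> F" using pick by blast
  ultimately show ?thesis by blast
qed

text \<open>Double counting: the \<open>k * card X\<close> edges at a subset \<open>X\<close> of
  \<open>P\<close> all end in its neighbourhood, whose vertices carry only \<open>k\<close> edges
  each. This is Hall's condition.\<close>

lemma regular_bipartite_matching:
  assumes "finite F" "finite P" "finite Q" "P \<inter> Q = {}" "k > 0"
    and bip: "\<And>e. e \<in> F \<Longrightarrow> \<exists>p\<in>P. \<exists>q\<in>Q. endset ends e = {p, q}"
    and reg: "\<And>v. v \<in> P \<union> Q \<Longrightarrow> deg_in F ends v = k"
  shows "\<exists>M\<subseteq>F. \<forall>v\<in>P \<union> Q. deg_in M ends v = 1"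
proof -
  have count: "card (edge_cut F ends X) = k * card X" if X: "X \<subseteq> P \<or> X \<subseteq> Q" for X
  proof -
    have "edges_inside F ends X = {}"
    proof (rule equals0I)
      fix e assume "e \<in> edges_inside F ends X"
      then have e: "e \<in> F" "endset ends e \<subseteq> X" unfolding edges_inside_def by auto
      from bip[OF e(1)] obtain p q where "p \<in> P" "q \<in> Q" "endset ends e = {p, q}" by blast
      then show False using e(2) X assms(4) by blast
    qed
    moreover have "finite X" using X assms(2,3) finite_subset by blast
    moreover have "(\<Sum>v\<in>X. deg_in F ends v) = (\<Sum>v\<in>X. k)" using X reg by (intro sum.cong) auto
    ultimately show ?thesis using handshake[OF assms(1), of X ends] by (simp add: mult.commute)
  qed
  define nb where "nb p = {q\<in>Q. adj F ends p q}" for p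
  have "\<exists>f. inj_on f P \<and> (\<forall>p\<in>P. f p \<in> nb p)"
  proof (rule hall_marriage[OF assms(2)])
    show "finite (nb p)" for p using assms(3) unfolding nb_def by simp
    fix X assume X: "X \<subseteq> P"
    have "edge_cut F ends X \<subseteq> edge_cut F ends (\<Union>(nb ` X))"
    proof
      fix e assume "e \<in> edge_cut F ends X"
      then have e: "e \<in> F" "(fst (ends e) \<in> X) \<noteq> (snd (ends e) \<in> X)" unfolding edge_cut_def by auto
      from bip[OF e(1)] obtain p q where pq: "p \<in> P" "q \<in> Q" "endset ends e = {p, q}" by blast
      have "q \<notin> X" using pq X assms(4) by blast
      moreover have "p \<in> X" using e(2) pq(3) \<open>q \<notin> X\<close> unfolding endset_def by (auto simp: doubleton_eq_iff)
      moreover have "q \<in> nb p" using pq e(1) unfolding nb_def adj_iff_endset by blast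
      moreover have "p \<notin> \<Union>(nb ` X)" using pq(1) assms(4) unfolding nb_def by blast
      ultimately show "e \<in> edge_cut F ends (\<Union>(nb ` X))"
        using pq(3) e(1) unfolding edge_cut_def endset_def by (auto simp: doubleton_eq_iff)
    qed
    then have "card (edge_cut F ends X) \<le> card (edge_cut F ends (\<Union>(nb ` X)))"
      using assms(1) by (intro card_mono) (auto simp: edge_cut_def)
    moreover have "\<Union>(nb ` X) \<subseteq> Q" unfolding nb_def by blast
    ultimately show "card X \<le> card (\<Union>(nb ` X))" using count X assms(5) by simp
  qed
  then obtain f where f: "inj_on f P" "\<forall>p\<in>P. f p \<in> nb p" by blast
  have fPQ: "f ` P \<subseteq> Q" using f(2) unfolding nb_def by blast
  \<comment> \<open>The whole edge set is the cut of either side, so the sides have equal size and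
    the injection is onto.\<close>
  have "edge_cut F ends P = F" "edge_cut F ends Q = F"
    using bip assms(4) unfolding edge_cut_def endset_def by (fastforce simp: doubleton_eq_iff)+
  then have "card P = card Q" using count[of P] count[of Q] assms(5) by simp
  then have fP: "f ` P = Q" using fPQ f(1) assms(3) by (simp add: card_image card_subset_eq)
  have "\<exists>N. pairing (adj F ends) (P \<union> f ` P) N"
    using f assms(4) fP by (intro pairing_inj) (auto simp: nb_def)
  then show ?thesis using pairing_edges[OF assms(1)] fP by metis
qed

text \<open>A nonempty edge set with at least as many edges as vertices, minimal with this property, is a
  circuit.\<close>

lemma circuit_exists:
  assumes "finite F" "F \<noteq> {}" "card (verts_of F ends) \<le> card F"
  shows "\<exists>C. circuit F ends C"
proof -
  let ?P = "\<lambda>C. C \<subseteq> F \<and> C \<noteq> {} \<and> card (verts_of C ends) \<le> card C"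
  obtain C where C: "?P C" and least: "\<And>D. ?P D \<Longrightarrow> card C \<le> card D"
    using ex_has_least_nat[of ?P F card] assms by auto
  let ?V = "verts_of C ends"
  have finC: "finite C" using C assms(1) finite_subset by blast
  have finV: "finite ?V" unfolding verts_of_endset using finC by simp
  have proper: "card D < card (verts_of D ends)" if "D \<subset> C" "D \<noteq> {}" for D
  proof (rule ccontr)
    assume "\<not> ?thesis"
    then have "card C \<le> card D" using that C by (intro least) auto
    then show False using that finC psubset_card_mono by (metis leD)
  qed
  \<comment> \<open>With more edges than vertices, one edge could be dropped without losing the
    property.\<close>
  have eq: "card ?V = card C"
  proof (rule ccontr)
    assume "card ?V \<noteq> card C"
    then have lt: "card ?V < card C" using C by simp
    obtain e where e: "e \<in> C" using C by blast
    have "card ?V > 0" using e finV unfolding verts_of_endset by (simp add: card_gt_0_iff) (use endset_nonempty in blast)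
    then have "card (C - {e}) > 0" using lt e finC by simp
    then have "C - {e} \<noteq> {}" by (metis card.empty less_irrefl)
    then have "card (C - {e}) < card (verts_of (C - {e}) ends)" using e by (intro proper) auto
    also have "\<dots> \<le> card ?V" using finV by (intro card_mono) (auto simp: verts_of_endset)
    finally show False using lt e finC by simp
  qed
  \<comment> \<open>Deleting a pendant edge loses one edge and at least one vertex, which again
    contradicts \<open>proper\<close>. A loop already contributes 2 to the degree.\<close>
  have ge2: "deg_in C ends v \<ge> 2" if v: "v \<in> ?V" for v
  proof (rule ccontr)
    assume lt: "\<not> ?thesis"
    obtain e where e: "e \<in> C" "v \<in> endset ends e" using v unfolding verts_of_endset by blast
    have split: "deg_in C ends w = deg_in (C - {e}) ends w + deg_in {e} ends w" for w
      using deg_in_Un[of "C - {e}" "{e}" ends w] finC e(1) by (simp add: insert_absorb)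
    have "deg_in {e} ends v \<ge> 1 \<and> (fst (ends e) = snd (ends e) \<longrightarrow> deg_in {e} ends v = 2)"
    proof -
      have "{x. x = e \<and> Q x} = (if Q e then {e} else {})" for Q by auto
      then show ?thesis using e(2) unfolding deg_in_def endset_def by auto
    qed
    then have noloop: "fst (ends e) \<noteq> snd (ends e)" and 0: "deg_in (C - {e}) ends v = 0"
      using split[of v] lt by auto
    have "v \<notin> verts_of (C - {e}) ends"
      using 0 finC unfolding deg_in_def verts_of_def by auto
    then have "verts_of (C - {e}) ends \<subseteq> ?V - {v}" unfolding verts_of_endset by blast
    then have le: "card (verts_of (C - {e}) ends) \<le> card ?V - 1"
      using finV v by (metis card_Diff_singleton card_mono finite_Diff)
    show False
    proof (cases "C = {e}")
      case True
      then show ?thesis using eq noloop by (simp add: verts_of_def)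
    next
      case False
      then have "card (C - {e}) < card (verts_of (C - {e}) ends)" using e by (intro proper) auto
      then show ?thesis using le eq e(1) finC by simp
    qed
  qed
  \<comment> \<open>Equally many edges and vertices make the average degree exactly 2, so minimum
    degree 2 forces degree 2 everywhere.\<close>
  have sum: "(\<Sum>v\<in>?V. deg_in C ends v) = (\<Sum>v\<in>?V. 2)"
  proof -
    have "edge_cut C ends ?V = {}" "edges_inside C ends ?V = C"
      unfolding edge_cut_def edges_inside_def verts_of_def endset_def by auto
    then show ?thesis using handshake[OF finC finV] eq by simp
  qed
  have deg2: "deg_in C ends v = 2" if v: "v \<in> ?V" for v
  proof (rule ccontr)
    assume "deg_in C ends v \<noteq> 2"
    then have "2 < deg_in C ends v" using ge2[OF v] by simp
    then have "(\<Sum>v\<in>?V. 2) < (\<Sum>v\<in>?V. deg_in C ends v)"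
      using ge2 finV v by (intro sum_strict_mono_ex1) auto
    then show False using sum by simp
  qed
  have conn: "reach C ends u w" if u: "u \<in> ?V" and w: "w \<in> ?V" for u w
  proof (rule ccontr)
    assume nr: "\<not> reach C ends u w"
    \<comment> \<open>The vertices reached from \<open>u\<close> split \<open>C\<close> into two
      proper parts, each with fewer edges than vertices, although the totals agree.\<close>
    define Z where "Z = {x\<in>?V. reach C ends u x}"
    have step: "y \<in> Z" if "e \<in> C" "x \<in> endset ends e" "y \<in> endset ends e" "x \<in> Z" for e x y
    proof -
      have "x = y \<or> adj C ends x y" using that unfolding adj_iff_endset endset_def by blast
      then have "reach C ends u y" using that(4) unfolding Z_def reach_def by (auto intro: rtranclp.rtrancl_into_rtrancl)
      then show ?thesis using that unfolding Z_def verts_of_endset by blast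
    qed
    let ?C1 = "{e\<in>C. endset ends e \<subseteq> Z}"
    let ?C2 = "{e\<in>C. endset ends e \<inter> Z = {}}"
    have uZ: "u \<in> Z" and wZ: "w \<notin> Z" using u nr unfolding Z_def reach_def by auto
    obtain e1 where e1: "e1 \<in> C" "u \<in> endset ends e1" using u unfolding verts_of_endset by blast
    have 1: "e1 \<in> ?C1" using e1 step uZ by blast
    obtain e2 where e2: "e2 \<in> C" "w \<in> endset ends e2" using w unfolding verts_of_endset by blast
    have 2: "e2 \<in> ?C2" using e2 step wZ by blast
    have un: "C = ?C1 \<union> ?C2" using step by blast
    have int: "?C1 \<inter> ?C2 = {}"
    proof (rule equals0I)
      fix e assume "e \<in> ?C1 \<inter> ?C2"
      then have "endset ends e = {}" by blast
      then show False by simp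
    qed
    have "card ?C1 < card (verts_of ?C1 ends)" using 1 2 int by (intro proper) blast+
    also have "\<dots> \<le> card Z"
    proof (rule card_mono)
      show "finite Z" using finV unfolding Z_def by simp
      show "verts_of ?C1 ends \<subseteq> Z" unfolding verts_of_endset by blast
    qed
    finally have c1: "card ?C1 < card Z" .
    have "card ?C2 < card (verts_of ?C2 ends)" using 1 2 int by (intro proper) blast+
    also have "\<dots> \<le> card (?V - Z)" using finV unfolding verts_of_endset by (intro card_mono) auto
    finally have c2: "card ?C2 < card (?V - Z)" .
    have "card C = card ?C1 + card ?C2"
      using un int finC by (metis (no_types, lifting) card_Un_disjoint finite_Un)
    moreover have "card ?V = card Z + card (?V - Z)"
    proof -
      have "Z \<subseteq> ?V" unfolding Z_def by blast
      then show ?thesis using finV by (metis card_Diff_subset card_mono finite_subset le_add_diff_inverse)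
    qed
    ultimately show False using c1 c2 eq by simp
  qed
  have "circuit F ends C" unfolding circuit_def using C finC deg2 conn by blast
  then show ?thesis by blast
qed

section \<open>Cuts in cyclically 4-edge-connected cubic graphs\<close>

locale c4c_cubic =
  fixes V :: "'v set" and E :: "'e set" and ends :: "'e \<Rightarrow> 'v \<times> 'v"
  assumes cubic: "cubic V E ends" and c4c: "cyc_edge_conn 4 V E ends"
begin

abbreviation "es \<equiv> endset ends"
abbreviation "\<delta> \<equiv> edge_cut E ends"
abbreviation "inside \<equiv> edges_inside E ends"

lemma finV: "finite V" and finE: "finite E"
  and deg3: "v \<in> V \<Longrightarrow> deg_in E ends v = 3"
  using cubic unfolding cubic_def multigraph_def by auto

lemma es_V: "e \<in> E \<Longrightarrow> es e \<subseteq> V"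
  using cubic unfolding cubic_def multigraph_def endset_def by auto

lemma finite_cut: "finite (\<delta> X)" and finite_inside: "finite (inside X)"
  using finE unfolding edge_cut_def edges_inside_def by auto

lemma cut_count:
  assumes "X \<subseteq> V" shows "3 * card X = card (\<delta> X) + 2 * card (inside X)"
proof -
  have "(\<Sum>v\<in>X. deg_in E ends v) = (\<Sum>v\<in>X. 3)" using assms deg3 by (intro sum.cong) auto
  then show ?thesis using handshake[OF finE finite_subset[OF assms finV], of ends] by simp
qed

lemma cut_complement: "X \<subseteq> V \<Longrightarrow> \<delta> (V - X) = \<delta> X"
  using es_V unfolding edge_cut_def endset_def by auto

lemma even_card_V: "even (card V)"
proof -
  have "\<delta> V = {}" using es_V unfolding edge_cut_def endset_def by auto
  then have "3 * card V = 2 * card (inside V)" using cut_count[of V] by simp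
  then have "even (3 * card V)" by simp
  then show ?thesis by simp
qed

text \<open>In 3|X| = cut + 2 * inner edges, a cut of at most |X| leaves at least |X| inner
  edges.\<close>

lemma circuit_inside:
  assumes "X \<subseteq> V" "X \<noteq> {}" "card (\<delta> X) \<le> card X"
  shows "\<exists>C. circuit (inside X) ends C"
proof (rule circuit_exists)
  have le: "card X \<le> card (inside X)" using cut_count[OF assms(1)] assms(3) by simp
  have finX: "finite X" using assms(1) finV finite_subset by blast
  then show "inside X \<noteq> {}" using le assms(2) card_gt_0_iff[of X] by auto
  have "verts_of (inside X) ends \<subseteq> X" unfolding verts_of_endset edges_inside_def by blast
  then show "card (verts_of (inside X) ends) \<le> card (inside X)" using le finX card_mono le_trans by blast
qed (rule finite_inside)

text \<open>Otherwise both sides contain circuits, and deleting the at most three cut edges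
  separates them.\<close>

lemma small_cut_side:
  assumes "X \<subseteq> V" "X \<noteq> {}" "X \<noteq> V" "card (\<delta> X) \<le> 3"
  shows "card X < card (\<delta> X) \<or> card (V - X) < card (\<delta> X)"
proof (rule ccontr)
  assume "\<not> ?thesis"
  then have "card (\<delta> X) \<le> card X" "card (\<delta> (V - X)) \<le> card (V - X)"
    using cut_complement[OF assms(1)] by auto
  moreover have "V - X \<noteq> {}" using assms(1,3) by blast
  ultimately obtain C D where C: "circuit (inside X) ends C" and D: "circuit (inside (V - X)) ends D"
    using circuit_inside[of X] circuit_inside[of "V - X"] assms by blast
  have "C \<subseteq> inside X" "D \<subseteq> inside (V - X)" using C D unfolding circuit_def by blast+
  have "inside X \<subseteq> E - \<delta> X" "inside (V - X) \<subseteq> E - \<delta> X"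
    unfolding edges_inside_def edge_cut_def endset_def by auto
  then have C': "circuit (E - \<delta> X) ends C" and D': "circuit (E - \<delta> X) ends D"
    using C D unfolding circuit_def by blast+
  have "verts_of C ends \<subseteq> X" "verts_of D ends \<subseteq> V - X"
    using \<open>C \<subseteq> inside X\<close> \<open>D \<subseteq> inside (V - X)\<close> unfolding verts_of_endset edges_inside_def by blast+
  moreover have "verts_of C ends \<noteq> {}" "verts_of D ends \<noteq> {}"
    using C D unfolding verts_of_def circuit_def by auto
  ultimately obtain u w where u: "u \<in> verts_of C ends" "u \<in> X" and w: "w \<in> verts_of D ends" "w \<notin> X"
    by blast
  have "y \<in> X" if "reach (E - \<delta> X) ends u y" for y
    using that unfolding reach_def
  proof (induction rule: rtranclp_induct)
    case (step y z)
    then show ?case unfolding adj_def edge_cut_def by auto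
  qed (rule u(2))
  then have "\<not> reach (E - \<delta> X) ends u w" using w by blast
  moreover have "\<delta> X \<subseteq> E" "card (\<delta> X) < 4" using assms(4) unfolding edge_cut_def by auto
  ultimately show False using c4c C' D' u(1) w(1) unfolding cyc_edge_conn_def by blast
qed

text \<open>The degree count makes |X| and its cut agree modulo 2. A side with fewer vertices than
  cut edges, with at most three of the latter, is therefore a single vertex with a cut of exactly
  three.\<close>

lemma cut_ge3:
  assumes "X \<subseteq> V" "X \<noteq> {}" "X \<noteq> V"
  shows "3 \<le> card (\<delta> X)" and "card (\<delta> X) = 3 \<Longrightarrow> card X = 1 \<or> card (V - X) = 1"
proof -
  have pos: "card X > 0" "card (V - X) > 0"
    using assms finV by (auto simp: card_gt_0_iff intro: finite_subset)
  have X: "3 * card X = card (\<delta> X) + 2 * card (inside X)" using cut_count assms(1) .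
  have Y: "3 * card (V - X) = card (\<delta> X) + 2 * card (inside (V - X))"
    using cut_count[of "V - X"] cut_complement[OF assms(1)] by simp
  have *: "card (\<delta> X) = 3 \<and> (card X = 1 \<or> card (V - X) = 1)" if "card (\<delta> X) \<le> 3"
  proof -
    have arith: "d = 3 \<and> x = 1" if "3 * x = d + 2 * i" "0 < x" "x < d" "d \<le> 3" for x d i :: nat
    proof -
      have "d = 2 \<or> d = 3" "x = 1 \<or> x = 2" using that by linarith+
      moreover have "d + 2 * i \<noteq> 3" if "d = 2" using that by presburger
      moreover have "d + 2 * i \<noteq> 6" if "d = 3" using that by presburger
      ultimately show ?thesis using that by auto
    qed
    show ?thesis using small_cut_side[OF assms that] arith[OF X pos(1) _ that] arith[OF Y pos(2) _ that] by blast
  qed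
  show "3 \<le> card (\<delta> X)" "card (\<delta> X) = 3 \<Longrightarrow> card X = 1 \<or> card (V - X) = 1"
    using * by linarith+
qed

lemma no_loop:
  assumes "e \<in> E" shows "fst (ends e) \<noteq> snd (ends e)"
proof
  assume loop: "fst (ends e) = snd (ends e)"
  let ?X = "{fst (ends e)}"
  have "e \<in> inside ?X" using assms loop unfolding edges_inside_def endset_def by auto
  then have "card (inside ?X) > 0" using finite_inside card_gt_0_iff by blast
  moreover have XV: "?X \<subseteq> V" using es_V[OF assms] unfolding endset_def by blast
  ultimately have "card (\<delta> ?X) < 3" using cut_count[of ?X] by simp
  \<comment> \<open>A one-vertex graph is excluded because the order is even.\<close>
  moreover have "?X \<noteq> V" using even_card_V by (metis card_1_singleton_iff One_nat_def odd_one)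
  ultimately show False using cut_ge3(1)[of ?X] XV by fastforce
qed

lemma card_es: "e \<in> E \<Longrightarrow> card (es e) = 2"
  using no_loop unfolding endset_def by simp

lemma es_other:
  assumes "e \<in> E" "x \<in> es e" obtains y where "es e = {x, y}" "y \<noteq> x" "y \<in> V"
  using assms no_loop[OF assms(1)] es_V[OF assms(1)] that unfolding endset_def by fastforce

lemma deg_card: "F \<subseteq> E \<Longrightarrow> deg_in F ends v = card {e\<in>F. v \<in> es e}"
  using no_loop finE by (intro deg_in_card) (auto intro: finite_subset)

lemma perfect_matching_iff:
  "perfect_matching V E ends M \<longleftrightarrow> M \<subseteq> E \<and> (\<forall>v\<in>V. \<exists>!e. e \<in> M \<and> v \<in> es e)"
proof -
  have "deg_in M ends v = 1 \<longleftrightarrow> (\<exists>!e. e \<in> M \<and> v \<in> es e)" if "M \<subseteq> E" for v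
    unfolding deg_card[OF that] One_nat_def card_1_singleton_iff set_eq_iff mem_Collect_eq singleton_iff by metis
  then show ?thesis unfolding perfect_matching_def by blast
qed

text \<open>At most two edges would leave the end pair of two parallel edges.
  \<open>card V > 2\<close> excludes the graph with two vertices and a triple edge.\<close>

lemma no_digon:
  assumes "card V > 2" "e \<in> E" "e' \<in> E" "es e = es e'" shows "e = e'"
proof (rule ccontr)
  assume "e \<noteq> e'"
  have "{e, e'} \<subseteq> inside (es e)" using assms unfolding edges_inside_def by auto
  then have "card {e, e'} \<le> card (inside (es e))" by (rule card_mono[OF finite_inside])
  then have "card (\<delta> (es e)) < 3"
    using cut_count[OF es_V[OF assms(2)]] card_es[OF assms(2)] \<open>e \<noteq> e'\<close> by simp
  then have "es e = V" using cut_ge3(1)[OF es_V[OF assms(2)]] by fastforce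
  then show False using assms(1) card_es[OF assms(2)] by simp
qed

text \<open>Every edge leaving a member ends in \<open>S\<close> or in the deleted set
  \<open>W\<close>, so the cuts of the members are disjoint pieces of one cut. \<open>W\<close> is
  empty for the existence of a perfect matching and is the hexagon later.\<close>

lemma barrier_cut:
  assumes "barrier (adj E ends) (V - W) S \<F>" "W \<subseteq> V"
  shows "(\<Union>X\<in>\<F>. \<delta> X) \<subseteq> \<delta> (S \<union> W)"
    and "card (\<Union>X\<in>\<F>. \<delta> X) = (\<Sum>X\<in>\<F>. card (\<delta> X))"
    and "X \<in> \<F> \<Longrightarrow> e \<in> E \<Longrightarrow> x \<in> X \<Longrightarrow> x \<in> es e \<Longrightarrow> es e \<subseteq> X \<union> S \<union> W"
proof -
  have \<F>: "X \<subseteq> V - W - S" "\<And>x y. x \<in> X \<Longrightarrow> y \<in> V - W - S - X \<Longrightarrow> \<not> adj E ends x y" if "X \<in> \<F>" for X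
    using assms(1) that unfolding barrier_def by blast+
  have dis: "X \<inter> Y = {}" if "X \<in> \<F>" "Y \<in> \<F>" "X \<noteq> Y" for X Y
    using barrier_disjoint[OF assms(1) that] .
  show sub: "es e \<subseteq> X \<union> S \<union> W" if X: "X \<in> \<F>" and e: "e \<in> E" and x: "x \<in> X" "x \<in> es e" for X e x
  proof -
    obtain y where y: "es e = {x, y}" "y \<in> V" using es_other[OF e x(2)] by metis
    then have "adj E ends x y" using e unfolding adj_iff_endset by blast
    then have "y \<in> X \<union> S \<union> W" using \<F>(2)[OF X x(1), of y] y(2) by blast
    then show ?thesis using y(1) x(1) by simp
  qed
  have cross: "\<exists>x\<in>X. \<exists>y\<in>S \<union> W. es e = {x, y}" if X: "X \<in> \<F>" and e: "e \<in> \<delta> X" for X e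
  proof -
    have eE: "e \<in> E" and "\<exists>x\<in>X. \<exists>y. y \<notin> X \<and> es e = {x, y}"
      using e unfolding edge_cut_def endset_def by auto
    then obtain x y where xy: "x \<in> X" "y \<notin> X" "es e = {x, y}" by blast
    then have "y \<in> S \<union> W" using sub[OF X eE xy(1)] by auto
    then show ?thesis using xy by blast
  qed
  show "(\<Union>X\<in>\<F>. \<delta> X) \<subseteq> \<delta> (S \<union> W)"
  proof
    fix e assume "e \<in> (\<Union>X\<in>\<F>. \<delta> X)"
    then obtain X where X: "X \<in> \<F>" "e \<in> \<delta> X" by blast
    then obtain x y where "x \<in> X" "y \<in> S \<union> W" "es e = {x, y}" using cross by blast
    moreover have "x \<notin> S \<union> W" using \<F>(1)[OF X(1)] \<open>x \<in> X\<close> by blast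
    ultimately show "e \<in> \<delta> (S \<union> W)"
      using X(2) unfolding edge_cut_def endset_def by (auto simp: doubleton_eq_iff)
  qed
  have "\<delta> X \<inter> \<delta> Y = {}" if XY: "X \<in> \<F>" "Y \<in> \<F>" "X \<noteq> Y" for X Y
  proof (rule equals0I)
    fix e assume e: "e \<in> \<delta> X \<inter> \<delta> Y"
    then obtain x y where xy: "x \<in> X" "y \<in> S \<union> W" "es e = {x, y}" using cross[OF XY(1)] by blast
    from e obtain x' y' where "x' \<in> Y" "y' \<in> S \<union> W" "es e = {x', y'}" using cross[OF XY(2)] by blast
    then show False using xy dis[OF XY] \<F>(1)[OF XY(1)] \<F>(1)[OF XY(2)] by (auto simp: doubleton_eq_iff)
  qed
  moreover have "finite \<F>" using barrier_finite[OF _ assms(1)] finV by blast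
  ultimately show "card (\<Union>X\<in>\<F>. \<delta> X) = (\<Sum>X\<in>\<F>. card (\<delta> X))"
    by (intro card_UN_disjoint) (auto simp: finite_cut)
qed

text \<open>Without this, the \<open>LEAST\<close> in the definition of the colouring defect could range over the empty
  predicate and be unspecified.\<close>

lemma perfect_matching_exists: "\<exists>M. perfect_matching V E ends M"
proof -
  have "\<nexists>S \<F>. barrier (adj E ends) V S \<F> \<and> card S < card \<F>"
  proof
    assume "\<exists>S \<F>. barrier (adj E ends) V S \<F> \<and> card S < card \<F>"
    then obtain S \<F> where bar: "barrier (adj E ends) V S \<F>" and large: "card S + 2 \<le> card \<F>"
      using barrier_parity[OF finV symp_adj even_card_V] by blast
    have fin: "finite \<F>" using bar barrier_finite finV by blast
    have SV: "S \<subseteq> V" using bar unfolding barrier_def by blast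
    have nonempty: "Y \<noteq> {}" if "Y \<in> \<F>" for Y using bar that unfolding barrier_def by fastforce
    \<comment> \<open>Petersen's argument: each odd member takes at least three of the at most 3|S|
      edges leaving \<open>S\<close>.\<close>
    have "3 \<le> card (\<delta> X)" if X: "X \<in> \<F>" for X
    proof (rule cut_ge3)
      show "X \<subseteq> V" using bar X unfolding barrier_def by blast
      have "\<F> \<noteq> {X}" using large by auto
      then obtain Y where Y: "Y \<in> \<F>" "Y \<noteq> X" using X by blast
      then have "X \<inter> Y = {}" using barrier_disjoint[OF bar X] by blast
      moreover have "Y \<subseteq> V" using bar Y unfolding barrier_def by blast
      ultimately show "X \<noteq> V" using nonempty[OF Y(1)] by blast
    qed (rule nonempty[OF X])
    then have "(\<Sum>X\<in>\<F>. 3) \<le> (\<Sum>X\<in>\<F>. card (\<delta> X))" by (rule sum_mono)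
    also have "\<dots> \<le> card (\<delta> S)"
      using barrier_cut(1,2)[of "{}" S \<F>] bar card_mono[OF finite_cut] by (metis Diff_empty Un_empty_right empty_subsetI)
    also have "\<dots> \<le> 3 * card S" using cut_count[OF SV] by simp
    finally show False using large by simp
  qed
  then obtain N where "pairing (adj E ends) V N" using tutte[OF finV symp_adj] by blast
  then obtain M where "M \<subseteq> E" "\<forall>v\<in>V. deg_in M ends v = 1" using pairing_edges[OF finE] by metis
  then show ?thesis unfolding perfect_matching_def by blast
qed

end

section \<open>The hexagonal core\<close>

text \<open>The union of two disjoint perfect matchings consists of alternating cycles of even
  length at least 4, and on six points only one 6-cycle fits.\<close>

lemma alternating_hexagon:
  fixes R Q :: "'a \<Rightarrow> 'a \<Rightarrow> bool"
  assumes card: "card W = 6" and sym: "symp R" "symp Q"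
    and exR: "\<And>x. x \<in> W \<Longrightarrow> \<exists>y\<in>W. R x y" and exQ: "\<And>x. x \<in> W \<Longrightarrow> \<exists>y\<in>W. Q x y"
    and uR: "\<And>x y z. R x y \<Longrightarrow> R x z \<Longrightarrow> y = z" and uQ: "\<And>x y z. Q x y \<Longrightarrow> Q x z \<Longrightarrow> y = z"
    and irr: "\<And>x. \<not> R x x" "\<And>x. \<not> Q x x" and RQ: "\<And>x y. R x y \<Longrightarrow> \<not> Q x y"
  obtains a b c d e f where "W = {a, b, c, d, e, f}" "distinct [a, b, c, d, e, f]"
    "R a b" "Q b c" "R c d" "Q d e" "R e f" "Q f a"
proof -
  have sR: "R y x" if "R x y" for x y using sym(1) that by (rule sympD)
  have sQ: "Q y x" if "Q x y" for x y using sym(2) that by (rule sympD)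
  have finW: "finite W" using card by (simp add: card_ge_0_finite)
  obtain a where a: "a \<in> W" using card by fastforce
  obtain b where b: "b \<in> W" "R a b" using exR[OF a] by blast
  obtain c where c: "c \<in> W" "Q b c" using exQ[OF b(1)] by blast
  obtain d where d: "d \<in> W" "R c d" using exR[OF c(1)] by blast
  obtain e where e: "e \<in> W" "Q d e" using exQ[OF d(1)] by blast
  obtain f where f: "f \<in> W" "R e f" using exR[OF e(1)] by blast
  have ab: "a \<noteq> b" using irr b by blast
  have c_ab: "c \<noteq> b" "c \<noteq> a" using irr c RQ[OF sR[OF b(2)]] by blast+
  have d_abc: "d \<noteq> c" "d \<noteq> b" "d \<noteq> a"
    using irr d(2) uR[OF b(2)] uR[OF sR[OF b(2)]] sR[OF d(2)] c_ab ab by blast+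
  have e_bcd: "e \<noteq> d" "e \<noteq> c" "e \<noteq> b"
    using irr e(2) RQ[OF sR[OF d(2)]] uQ[OF c(2)] sQ[OF e(2)] d_abc by blast+
  \<comment> \<open>If the walk closed after four steps, the two leftover points would be partners
    of each other under both relations.\<close>
  have e_a: "e \<noteq> a"
  proof
    assume "e = a"
    have "card (W - {a, b, c, d}) = 2"
      using a b c d ab c_ab d_abc card finW by (subst card_Diff_subset) auto
    then obtain x y where xy: "W - {a, b, c, d} = {x, y}" "x \<noteq> y" by (meson card_2_iff)
    then have x: "x \<in> W" "x \<notin> {a, b, c, d}" by blast+
    have cycle: "R b a" "R d c" "Q c b" "Q a d" using sR b d sQ c e \<open>e = a\<close> by blast+
    obtain y1 where y1: "y1 \<in> W" "R x y1" using exR[OF x(1)] by blast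
    have "y1 \<notin> {a, b, c, d}" using x(2) sR[OF y1(2)] uR b(2) d(2) cycle by blast
    then have "y1 \<in> {x, y}" using y1(1) unfolding xy(1)[symmetric] by simp
    moreover have "y1 \<noteq> x" using y1(2) irr(1) by blast
    ultimately have "y1 = y" by simp
    obtain y2 where y2: "y2 \<in> W" "Q x y2" using exQ[OF x(1)] by blast
    have "y2 \<notin> {a, b, c, d}" using x(2) sQ[OF y2(2)] uQ c(2) e(2) \<open>e = a\<close> cycle by blast
    then have "y2 \<in> {x, y}" using y2(1) unfolding xy(1)[symmetric] by simp
    moreover have "y2 \<noteq> x" using y2(2) irr(2) by blast
    ultimately have "y2 = y" by simp
    then show False using RQ y1(2) y2(2) \<open>y1 = y\<close> by blast
  qed
  have "f \<noteq> e" using irr f(2) by blast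
  moreover have "f \<noteq> d" using uR[OF sR[OF d(2)], of e] sR[OF f(2)] e_bcd by blast
  moreover have "f \<noteq> c" using uR[OF d(2), of e] sR[OF f(2)] e_bcd by blast
  moreover have "f \<noteq> b" using uR[OF sR[OF b(2)], of e] sR[OF f(2)] e_a by blast
  moreover have "f \<noteq> a" using uR[OF b(2), of e] sR[OF f(2)] e_bcd by blast
  ultimately have f_new: "f \<noteq> e" "f \<noteq> d" "f \<noteq> c" "f \<noteq> b" "f \<noteq> a" by blast+
  have dist: "distinct [a, b, c, d, e, f]" using ab c_ab d_abc e_bcd e_a f_new by auto
  have "card {a, b, c, d, e, f} = 6" using distinct_card[OF dist] by simp
  then have W: "W = {a, b, c, d, e, f}"
    using a b c d e f card finW by (metis (no_types, lifting) card_subset_eq empty_subsetI insert_subset)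
  obtain g where g: "g \<in> W" "Q f g" using exQ[OF f(1)] by blast
  have "g \<noteq> f" using irr g by blast
  moreover have "g \<noteq> e" using RQ[OF sR[OF f(2)]] g by blast
  moreover have "g \<noteq> d" using uQ[OF e(2), of f] sQ[OF g(2)] f_new by blast
  moreover have "g \<noteq> c" using uQ[OF sQ[OF c(2)], of f] sQ[OF g(2)] f_new by blast
  moreover have "g \<noteq> b" using uQ[OF c(2), of f] sQ[OF g(2)] f_new by blast
  ultimately have "g = a" using g(1) W by blast
  then show thesis using that[OF W dist] b c d e f g by blast
qed

context c4c_cubic
begin

text \<open>Chords are permitted here; they are excluded only by
  \<open>bipartite_outside\<close>.\<close>

definition hexagon :: "'v \<Rightarrow> 'v \<Rightarrow> 'v \<Rightarrow> 'v \<Rightarrow> 'v \<Rightarrow> 'v \<Rightarrow> bool" where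
  "hexagon a b c d e f \<longleftrightarrow> distinct [a, b, c, d, e, f] \<and> adj E ends a b \<and> adj E ends b c \<and>
     adj E ends c d \<and> adj E ends d e \<and> adj E ends e f \<and> adj E ends f a"

lemma hexagon_rotate: "hexagon a b c d e f \<Longrightarrow> hexagon b c d e f a"
  unfolding hexagon_def by auto

lemma edge_count: "3 * card V = 2 * card E"
proof -
  have "\<delta> V = {}" "inside V = E" using es_V unfolding edge_cut_def edges_inside_def endset_def by auto
  then show ?thesis using cut_count[of V] by simp
qed

lemma card_inc: "v \<in> V \<Longrightarrow> card {e\<in>E. v \<in> es e} = 3"
  using deg3 deg_card[of E v] by simp

text \<open>Each vertex is either met by three different matching edges, or has exactly one edge
  covered twice and exactly one uncovered. So the three edges of \<open>U\<close> are disjoint, the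
  doubly covered edges match the same six vertices, and the absence of digons makes the two
  matchings disjoint as vertex pairs.\<close>

lemma core_hexagon:
  assumes M: "perfect_matching V E ends M1" "perfect_matching V E ends M2" "perfect_matching V E ends M3"
    and U: "U = E - (M1 \<union> M2 \<union> M3)" "card U = 3"
  obtains a b c d e f where "hexagon a b c d e f"
    "\<forall>v\<in>{a, b, c, d, e, f}. deg_in U ends v = 1" "\<forall>g\<in>U. es g \<subseteq> {a, b, c, d, e, f}"
proof -
  have ME: "M1 \<subseteq> E" "M2 \<subseteq> E" "M3 \<subseteq> E" and UE: "U \<subseteq> E"
    using M U(1) unfolding perfect_matching_def by blast+
  have finU: "finite U" using UE finE finite_subset by blast
  have mate: "\<exists>m. {e\<in>M. v \<in> es e} = {m}" if "perfect_matching V E ends M" "v \<in> V" for M v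
  proof -
    have "\<exists>!e. e \<in> M \<and> v \<in> es e" using that unfolding perfect_matching_iff by blast
    then obtain m where "m \<in> M \<and> v \<in> es m" "\<And>e. e \<in> M \<and> v \<in> es e \<Longrightarrow> e = m" by (elim ex1E) blast
    then have "{e\<in>M. v \<in> es e} = {m}" by blast
    then show ?thesis by blast
  qed
  let ?inc = "\<lambda>F v. {e\<in>F. v \<in> es e}"
  define D where "D = (M1 \<inter> M2) \<union> (M1 \<inter> M3) \<union> (M2 \<inter> M3)"
  \<comment> \<open>An edge in all three matchings leaves two uncovered edges at each of its ends.
    Two such pairs among only three edges share an edge, which is then parallel to the given
    one.\<close>
  have triple: "M1 \<inter> M2 \<inter> M3 = {}"
  proof (rule equals0I)
    fix g assume g: "g \<in> M1 \<inter> M2 \<inter> M3"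
    then have gE: "g \<in> E" and gU: "g \<notin> U" using ME U(1) by blast+
    have "card (insert g U) = 4" using gU finU U(2) by simp
    then have "card E \<ge> 4" using gE UE finE by (metis card_mono insert_subset)
    then have V2: "card V > 2" using edge_count by simp
    obtain x y where xy: "es g = {x, y}" "x \<noteq> y" by (metis card_es[OF gE] card_2_iff)
    have two: "card (?inc U v) = 2" if v: "v \<in> es g" for v
    proof -
      have vV: "v \<in> V" using es_V[OF gE] v by blast
      have "?inc M v = {g}" if pm: "perfect_matching V E ends M" "g \<in> M" for M
      proof -
        obtain m where m: "?inc M v = {m}" using mate[OF pm(1) vV] by blast
        moreover have "g \<in> ?inc M v" using pm(2) v by blast
        ultimately show ?thesis by simp
      qed
      then have "?inc M1 v = {g}" "?inc M2 v = {g}" "?inc M3 v = {g}" using M g by blast+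
      then have "?inc U v = ?inc E v - {g}" unfolding U(1) by blast
      then show ?thesis using card_inc[OF vV] gE v by simp
    qed
    have "card (?inc U x \<union> ?inc U y) \<le> 3" using U(2) finU by (metis (no_types, lifting) Un_subset_iff card_mono mem_Collect_eq subsetI)
    then have "card (?inc U x \<inter> ?inc U y) > 0"
      using card_Un_Int[of "?inc U x" "?inc U y"] finU two xy by simp
    then obtain k where k: "k \<in> U" "x \<in> es k" "y \<in> es k" by (auto simp: card_gt_0_iff)
    then have "es k = es g"
      using xy UE card_es[of k] by (intro card_subset_eq[symmetric]) auto
    then show False using no_digon[OF V2 gE, of k] k(1) UE gU by auto
  qed
  \<comment> \<open>Exactly two of the three matching edges at a vertex can coincide, or none; each
    case fixes both counts.\<close>
  have local: "(?inc U v = {} \<and> ?inc D v = {}) \<or> (\<exists>u d. ?inc U v = {u} \<and> ?inc D v = {d})"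
    if v: "v \<in> V" for v
  proof -
    obtain m1 m2 m3 where m: "?inc M1 v = {m1}" "?inc M2 v = {m2}" "?inc M3 v = {m3}"
      using mate[OF M(1) v] mate[OF M(2) v] mate[OF M(3) v] by blast
    have "?inc U v = ?inc E v - ({m1} \<union> {m2} \<union> {m3})" and UD2:
      "?inc D v = ({m1} \<inter> {m2}) \<union> ({m1} \<inter> {m3}) \<union> ({m2} \<inter> {m3})"
      unfolding U(1) D_def m[symmetric] by blast+
    then have UD: "?inc U v = ?inc E v - {m1, m2, m3}" by (simp add: insert_commute)
    have sub: "{m1, m2, m3} \<subseteq> ?inc E v" using m ME by blast
    have cU: "card (?inc U v) = 3 - card {m1, m2, m3}"
      unfolding UD using card_inc[OF v] sub by (subst card_Diff_subset) auto
    have "\<not> (m1 = m2 \<and> m2 = m3)" using m triple by blast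
    then consider "m1 \<noteq> m2" "m1 \<noteq> m3" "m2 \<noteq> m3" | "m1 = m2" "m1 \<noteq> m3" | "m1 = m3" "m1 \<noteq> m2" | "m2 = m3" "m1 \<noteq> m2"
      by blast
    then show ?thesis
    proof cases
      case 1
      then have "card (?inc U v) = 0" using cU by simp
      then have "?inc U v = {}" using finU by simp
      then show ?thesis using UD2 1 by simp
    next
      case 2
      then have "card (?inc U v) = 1" using cU by simp
      then show ?thesis using UD2 2 by (auto simp: card_1_singleton_iff)
    next
      case 3
      then have "card (?inc U v) = 1" using cU by (simp add: insert_commute)
      then show ?thesis using UD2 3 by (auto simp: card_1_singleton_iff)
    next
      case 4
      then have "card (?inc U v) = 1" using cU by simp
      then show ?thesis using UD2 4 by (auto simp: card_1_singleton_iff)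
    qed
  qed
  have at_most_one: "\<exists>d. ?inc U v \<subseteq> {d}" "\<exists>d. ?inc D v \<subseteq> {d}" if "v \<in> V" for v
    using local[OF that] by (metis empty_subsetI subset_refl)+
  define W where "W = {v\<in>V. ?inc U v \<noteq> {}}"
  have WV: "W \<subseteq> V" unfolding W_def by blast
  have DE: "D \<subseteq> E" unfolding D_def using ME by blast
  have W_one: "\<exists>u d. ?inc U v = {u} \<and> ?inc D v = {d}" if "v \<in> W" for v
    using local[of v] that unfolding W_def by blast
  have W_D: "v \<in> W" if "v \<in> V" "?inc D v \<noteq> {}" for v
    using local[of v] that unfolding W_def by blast
  have U_W: "es g \<subseteq> W" if "g \<in> U" for g
    using es_V[of g] UE that unfolding W_def by blast
  have cardW: "card W = 6"
  proof -
    have "edge_cut U ends W = {}" "edges_inside U ends W = U"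
      using U_W unfolding edge_cut_def edges_inside_def endset_def by auto
    then have "(\<Sum>v\<in>W. deg_in U ends v) = 6"
      using handshake[OF finU finite_subset[OF WV finV], of ends] U(2) by simp
    moreover have "deg_in U ends v = 1" if "v \<in> W" for v
      using W_one[OF that] deg_card[OF UE, of v] by auto
    ultimately show ?thesis by simp
  qed
  then have V2: "card V > 2" using card_mono[OF finV WV] by simp
  have adjV: "x \<in> V" if "adj F ends x y" "F \<subseteq> E" for F x y
    using that es_V unfolding adj_iff_endset by (metis insertI1 subsetD)
  have uniq: "y = z" if adj: "adj F ends x y" "adj F ends x z" "F \<subseteq> E" "x \<in> V \<Longrightarrow> \<exists>d. {g\<in>F. x \<in> es g} \<subseteq> {d}" for F x y z
  proof -
    obtain g h where gh: "g \<in> F" "es g = {x, y}" "h \<in> F" "es h = {x, z}"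
      using adj(1,2) unfolding adj_iff_endset by blast
    obtain d where "{g\<in>F. x \<in> es g} \<subseteq> {d}" using adj(4) adjV[OF adj(1,3)] by blast
    then have "g = h" using gh by blast
    then show ?thesis using gh by (metis doubleton_eq_iff)
  qed
  have irr: "\<not> adj F ends x x" if "F \<subseteq> E" for F x
  proof
    assume "adj F ends x x"
    then obtain g where "g \<in> F" "es g = {x, x}" unfolding adj_iff_endset by blast
    then show False using card_es[of g] that by auto
  qed
  have ex: "\<exists>y\<in>V. adj F ends x y \<and> {g\<in>F. y \<in> es g} \<noteq> {}" if g: "g \<in> F" "x \<in> es g" "F \<subseteq> E" for F g x
  proof -
    obtain y where "es g = {x, y}" "y \<in> V" using es_other[of g x] g by blast
    then show ?thesis using g(1) unfolding adj_iff_endset by blast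
  qed
  obtain a b c d e f where hex: "W = {a, b, c, d, e, f}" "distinct [a, b, c, d, e, f]"
    "adj U ends a b" "adj D ends b c" "adj U ends c d" "adj D ends d e" "adj U ends e f" "adj D ends f a"
  proof (rule alternating_hexagon[OF cardW symp_adj symp_adj, of U ends D ends])
    fix x assume x: "x \<in> W"
    then obtain u d where ud: "?inc U x = {u}" "?inc D x = {d}" using W_one by blast
    have "u \<in> U" "x \<in> es u" using ud by blast+
    from ex[OF this UE] show "\<exists>y\<in>W. adj U ends x y" unfolding W_def by blast
    have "d \<in> D" "x \<in> es d" using ud by blast+
    from ex[OF this DE] show "\<exists>y\<in>W. adj D ends x y" using W_D by blast
  next
    fix x y z assume "adj U ends x y" "adj U ends x z"
    then show "y = z" using at_most_one by (intro uniq[OF _ _ UE]) blast+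
  next
    fix x y z assume "adj D ends x y" "adj D ends x z"
    then show "y = z" using at_most_one by (intro uniq[OF _ _ DE]) blast+
  next
    fix x y assume "adj U ends x y"
    then obtain g where g: "g \<in> U" "es g = {x, y}" unfolding adj_iff_endset by blast
    show "\<not> adj D ends x y"
    proof
      assume "adj D ends x y"
      then obtain h where "h \<in> D" "es h = {x, y}" unfolding adj_iff_endset by blast
      then have "g = h" "g \<notin> D" using no_digon[OF V2, of g h] g UE DE unfolding U(1) D_def by auto
      then show False using \<open>h \<in> D\<close> by blast
    qed
  qed (use irr UE DE in blast)+
  have lift: "adj E ends x y" if "adj F ends x y" "F \<subseteq> E" for F x y
    using that unfolding adj_def by blast
  have "hexagon a b c d e f"
    unfolding hexagon_def using hex lift UE DE by blast
  then show thesis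
  proof (rule that)
    show "\<forall>v\<in>{a, b, c, d, e, f}. deg_in U ends v = 1"
      using W_one deg_card[OF UE] unfolding hex(1)[symmetric] by fastforce
    show "\<forall>g\<in>U. es g \<subseteq> {a, b, c, d, e, f}" using U_W unfolding hex(1) by (intro ballI)
  qed
qed

end

section \<open>The graph outside the hexagon\<close>

lemma rotate6: "{q, r, s, t, u, p} = {p, q, r, s, t, u}"
  by blast

context c4c_cubic
begin

text \<open>A perfect matching of the subgraph induced on \<open>A\<close>; keeping the edges within
  \<open>A\<close> lets matchings of disjoint sets be united.\<close>

definition matches :: "'e set \<Rightarrow> 'v set \<Rightarrow> bool" where
  "matches M A \<longleftrightarrow> M \<subseteq> E \<and> (\<forall>e\<in>M. es e \<subseteq> A) \<and> (\<forall>v\<in>A. deg_in M ends v = 1)"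

lemma matches_Un:
  assumes "matches M A" "matches M' B" "A \<inter> B = {}" shows "matches (M \<union> M') (A \<union> B)"
proof -
  have "finite M" "finite M'" using assms finE unfolding matches_def by (auto intro: finite_subset)
  then have "deg_in (M \<union> M') ends v = 1" if "v \<in> A \<union> B" for v
    using assms that unfolding matches_def by (intro deg_in_Un_eq_1[of M M' A B]) auto
  then show ?thesis using assms unfolding matches_def by blast
qed

lemma matches_single: "g \<in> E \<Longrightarrow> es g = {x, y} \<Longrightarrow> matches {g} {x, y}"
  unfolding matches_def by (simp add: deg_card Collect_conv_if)

lemma matches_V: "matches M V \<longleftrightarrow> perfect_matching V E ends M"
  unfolding matches_def perfect_matching_def using es_V by blast

lemma pairing_matches: "pairing (adj E ends) W N \<Longrightarrow> \<exists>M. matches M W"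
  using pairing_edges[OF finE] unfolding matches_def by blast

lemma hexagon_edges:
  assumes "hexagon a b c d e f"
  obtains H where "H \<subseteq> E" "card H = 6" "es ` H = {{a, b}, {b, c}, {c, d}, {d, e}, {e, f}, {f, a}}"
proof -
  obtain h1 h2 h3 h4 h5 h6 where h: "es h1 = {a, b}" "es h2 = {b, c}" "es h3 = {c, d}"
    "es h4 = {d, e}" "es h5 = {e, f}" "es h6 = {f, a}" "{h1, h2, h3, h4, h5, h6} \<subseteq> E"
    using assms unfolding hexagon_def adj_iff_endset by (metis (no_types, lifting) empty_subsetI insert_subset)
  have "distinct [a, b, c, d, e, f]" using assms unfolding hexagon_def by blast
  then have "distinct (map es [h1, h2, h3, h4, h5, h6])" using h by (auto simp: doubleton_eq_iff)
  then have "distinct [h1, h2, h3, h4, h5, h6]" by (meson distinct_map)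
  then have "card {h1, h2, h3, h4, h5, h6} = 6" using distinct_card[of "[h1, h2, h3, h4, h5, h6]"] by simp
  moreover have "es ` {h1, h2, h3, h4, h5, h6} = {{a, b}, {b, c}, {c, d}, {d, e}, {e, f}, {f, a}}"
    using h by simp
  ultimately show thesis using that h(7) by blast
qed

lemma hexagon_V:
  assumes "hexagon a b c d e f"
  shows "{a, b, c, d, e, f} \<subseteq> V" "card {a, b, c, d, e, f} = 6" "card V > 2"
proof -
  have "x \<in> V" if "adj E ends x y" for x y
    using that es_V unfolding adj_iff_endset by (metis insertI1 subsetD)
  then show sub: "{a, b, c, d, e, f} \<subseteq> V" using assms unfolding hexagon_def by blast
  have "distinct [a, b, c, d, e, f]" using assms unfolding hexagon_def by blast
  then show six: "card {a, b, c, d, e, f} = 6" using distinct_card[of "[a, b, c, d, e, f]"] by simp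
  show "card V > 2" using card_mono[OF finV sub] six by simp
qed

text \<open>As \<open>T\<close> is disjoint from \<open>S\<close> and from the hexagon, the last
  clause rules out chords, edges within \<open>S\<close> or within \<open>T\<close>, and edges from
  \<open>S\<close> to the hexagon.\<close>

definition bipartite_outside :: "'v \<Rightarrow> 'v \<Rightarrow> 'v \<Rightarrow> 'v \<Rightarrow> 'v \<Rightarrow> 'v \<Rightarrow> 'v set \<Rightarrow> 'v set \<Rightarrow> bool" where
  "bipartite_outside a b c d e f S T \<longleftrightarrow> hexagon a b c d e f \<and> V = {a, b, c, d, e, f} \<union> S \<union> T \<and>
     S \<inter> {a, b, c, d, e, f} = {} \<and> T \<inter> {a, b, c, d, e, f} = {} \<and> S \<inter> T = {} \<and> card T = card S + 2 \<and>
     (\<forall>g\<in>E. es g \<in> {{a, b}, {b, c}, {c, d}, {d, e}, {e, f}, {f, a}} \<or>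
        (\<exists>t\<in>T. \<exists>x\<in>S \<union> {a, b, c, d, e, f}. es g = {t, x}))"

lemma bipartite_outsideD:
  assumes "bipartite_outside a b c d e f S T"
  shows "hexagon a b c d e f" "V = {a, b, c, d, e, f} \<union> S \<union> T" "S \<inter> {a, b, c, d, e, f} = {}"
    "T \<inter> {a, b, c, d, e, f} = {}" "S \<inter> T = {}" "card T = card S + 2"
    and "g \<in> E \<Longrightarrow> es g \<in> {{a, b}, {b, c}, {c, d}, {d, e}, {e, f}, {f, a}} \<or>
        (\<exists>t\<in>T. \<exists>x\<in>S \<union> {a, b, c, d, e, f}. es g = {t, x})"
proof -
  note all = assms[unfolded bipartite_outside_def]
  show "hexagon a b c d e f" "V = {a, b, c, d, e, f} \<union> S \<union> T" "S \<inter> {a, b, c, d, e, f} = {}"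
    "T \<inter> {a, b, c, d, e, f} = {}" "S \<inter> T = {}" "card T = card S + 2"
    using all by - (elim conjE, assumption)+
  show "g \<in> E \<Longrightarrow> es g \<in> {{a, b}, {b, c}, {c, d}, {d, e}, {e, f}, {f, a}} \<or>
        (\<exists>t\<in>T. \<exists>x\<in>S \<union> {a, b, c, d, e, f}. es g = {t, x})"
    using all by (elim conjE) (rule bspec)
qed

text \<open>The symmetry that carries facts about \<open>a\<close>, or about the pair
  \<open>a\<close>, \<open>d\<close>, to the other hexagon vertices.\<close>

lemma bipartite_outside_rotate:
  assumes "bipartite_outside a b c d e f S T" shows "bipartite_outside b c d e f a S T"
proof -
  have "\<forall>g\<in>E. es g \<in> {{b, c}, {c, d}, {d, e}, {e, f}, {f, a}, {a, b}} \<or>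
      (\<exists>t\<in>T. \<exists>x\<in>S \<union> {a, b, c, d, e, f}. es g = {t, x})"
    using assms unfolding bipartite_outside_def rotate6[where p = "{a, b}"] by (elim conjE)
  moreover have "hexagon b c d e f a" using assms hexagon_rotate unfolding bipartite_outside_def by blast
  ultimately show ?thesis using assms
    unfolding bipartite_outside_def rotate6[where p = a] by (elim conjE, intro conjI)
qed

text \<open>Tutte's barrier is forced into equality, and each equality yields one feature: the odd
  parts are single vertices, the only edges inside \<open>S \<union> W\<close> are the hexagon
  sides, and every other edge at \<open>S \<union> W\<close> ends in \<open>T\<close>.\<close>

lemma bipartite_outside_if_no_matching:
  assumes hex: "hexagon a b c d e f" and none: "\<nexists>M. matches M (V - {a, b, c, d, e, f})"
  shows "\<exists>S T. bipartite_outside a b c d e f S T"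
proof -
  define W where "W = {a, b, c, d, e, f}"
  have W: "W \<subseteq> V" "card W = 6" using hexagon_V[OF hex] unfolding W_def by auto
  have finW: "finite W" unfolding W_def by simp
  have fin: "finite (V - W)" using finV by simp
  have "card (V - W) + 6 = card V" using W finV by (metis card_Diff_subset card_mono finW le_add_diff_inverse2)
  then have even: "even (card (V - W))" using even_card_V by (metis even_add even_numeral)
  have "\<nexists>N. pairing (adj E ends) (V - W) N" using none pairing_matches unfolding W_def by blast
  then obtain S \<F> where bar: "barrier (adj E ends) (V - W) S \<F>" and large: "card S + 2 \<le> card \<F>"
    using tutte[OF fin symp_adj[of E ends]] barrier_parity[OF fin symp_adj even] by blast
  have finF: "finite \<F>" using barrier_finite[OF fin bar] .
  have S: "S \<subseteq> V - W" using bar unfolding barrier_def by blast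
  have SW: "S \<union> W \<subseteq> V" "card (S \<union> W) = card S + 6"
    using S W finV finW by (auto intro!: card_Un_disjoint[of S W, unfolded W(2)] intro: finite_subset)
  have X: "X \<subseteq> V - W - S" "odd (card X)" if "X \<in> \<F>" for X
    using bar that unfolding barrier_def by blast+
  have X3: "3 \<le> card (\<delta> X)" "card (\<delta> X) = 3 \<Longrightarrow> card X = 1" if XF: "X \<in> \<F>" for X
  proof -
    have "X \<noteq> {}" using X(2)[OF XF] by auto
    \<comment> \<open>The hexagon lies on the far side of the cut, so when a 3-cut isolates a
      vertex, that vertex is \<open>X\<close>.\<close>
    moreover have "W \<subseteq> V - X" using X(1)[OF XF] W by blast
    then have "card (V - X) \<ge> 6" using W(2) finV by (metis card_mono finite_Diff)
    moreover then have "X \<noteq> V" by auto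
    moreover have "X \<subseteq> V" using X(1)[OF XF] by blast
    ultimately show "3 \<le> card (\<delta> X)" "card (\<delta> X) = 3 \<Longrightarrow> card X = 1" using cut_ge3[of X] by auto
  qed
  obtain H where H: "H \<subseteq> E" "card H = 6" "es ` H = {{a, b}, {b, c}, {c, d}, {d, e}, {e, f}, {f, a}}"
    using hexagon_edges[OF hex] .
  have "\<Union>(es ` H) \<subseteq> W" unfolding H(3) W_def by blast
  then have Hin: "H \<subseteq> inside (S \<union> W)" using H(1) unfolding edges_inside_def by blast
  have in6: "6 \<le> card (inside (S \<union> W))" using card_mono[OF finite_inside Hin] H(2) by simp
  have count: "3 * (card S + 6) = card (\<delta> (S \<union> W)) + 2 * card (inside (S \<union> W))"
    using cut_count[OF SW(1)] SW(2) by simp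
  note bc = barrier_cut[OF bar W(1)]
  have sum_le: "(\<Sum>X\<in>\<F>. card (\<delta> X)) \<le> card (\<delta> (S \<union> W))"
    using card_mono[OF finite_cut bc(1)] bc(2) by simp
  have sum_ge: "(\<Sum>X\<in>\<F>. 3) \<le> (\<Sum>X\<in>\<F>. card (\<delta> X))" using X3 by (intro sum_mono) auto
  \<comment> \<open>The chain 3|S| + 6 \<le> 3|\<F>| \<le> sum of cuts \<le> cut of
    \<open>S \<union> W\<close> \<le> 3(|S| + 6) - 12 collapses.\<close>
  have eqs: "card \<F> = card S + 2" "card (inside (S \<union> W)) = 6"
    "(\<Sum>X\<in>\<F>. 3) = (\<Sum>X\<in>\<F>. card (\<delta> X))" "(\<Sum>X\<in>\<F>. card (\<delta> X)) = card (\<delta> (S \<union> W))"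
    using sum_le sum_ge count in6 large by simp_all
  have inH: "inside (S \<union> W) = H" using Hin eqs(2) H(2) finite_inside card_subset_eq by metis
  have cut: "(\<Union>X\<in>\<F>. \<delta> X) = \<delta> (S \<union> W)"
    using bc(1,2) eqs(4) finite_cut by (intro card_subset_eq) auto
  have single: "card X = 1" if "X \<in> \<F>" for X
    using sum_mono_inv[OF eqs(3) _ that finF] X3 that by auto
  define T where "T = \<Union>\<F>"
  have T: "T \<subseteq> V - W - S" using X unfolding T_def by blast
  have "card T = (\<Sum>X\<in>\<F>. card X)"
    unfolding T_def using bar single
    by (intro card_Union_disjoint) (auto simp: barrier_def intro: card_ge_0_finite)
  then have cardT: "card T = card S + 2" using single eqs(1) by simp
  have T_edge: "\<exists>x\<in>S \<union> W. es g = {t, x}" if g: "g \<in> E" and t: "t \<in> T" "t \<in> es g" for g t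
  proof -
    obtain Y where Y: "Y \<in> \<F>" "t \<in> Y" using t(1) unfolding T_def by blast
    have "Y = {t}" using single[OF Y(1)] Y(2) by (metis card_1_singletonE singletonD)
    then have "es g \<subseteq> {t} \<union> S \<union> W" using bc(3)[OF Y(1) g Y(2) t(2)] by simp
    moreover obtain y where "es g = {t, y}" "y \<noteq> t" using es_other[OF g t(2)] by blast
    ultimately show ?thesis by auto
  qed
  \<comment> \<open>Vertices in no part of the barrier. All edges leaving
    \<open>S \<union> W\<close> are used up by \<open>T\<close>, and \<open>T\<close> sends edges
    only to \<open>S \<union> W\<close>, so a nonempty \<open>Z\<close> would have an empty
    cut.\<close>
  define Z where "Z = V - W - S - T"
  have "\<delta> Z = {}"
  proof (rule equals0I)
    fix g assume g: "g \<in> \<delta> Z"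
    then have gE: "g \<in> E" and "\<exists>z\<in>Z. \<exists>y. y \<notin> Z \<and> es g = {z, y}" unfolding edge_cut_def endset_def by auto
    then obtain z y where zy: "z \<in> Z" "y \<notin> Z" "es g = {z, y}" by blast
    show False
    proof (cases "y \<in> T")
      case True
      then obtain x where "x \<in> S \<union> W" "es g = {y, x}" using T_edge[OF gE True] zy(3) by auto
      then have "z = y \<or> z = x" using zy(3) by blast
      then show False using zy(1) True \<open>x \<in> S \<union> W\<close> unfolding Z_def by blast
    next
      case False
      then have y: "y \<in> S \<union> W" using zy es_V[OF gE] unfolding Z_def by blast
      have "z \<notin> S \<union> W" using zy(1) unfolding Z_def by blast
      then have "g \<in> \<delta> (S \<union> W)"
        using y zy(3) gE unfolding edge_cut_def endset_def by (auto simp: doubleton_eq_iff)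
      then obtain Y where "Y \<in> \<F>" "g \<in> \<delta> Y" unfolding cut[symmetric] by blast
      then obtain t where "t \<in> T" "t \<in> es g" unfolding T_def edge_cut_def endset_def by blast
      then have "t = z \<or> t = y" using zy(3) by auto
      then show False using \<open>t \<in> T\<close> zy(1) False unfolding Z_def by blast
    qed
  qed
  moreover have "a \<in> V" "a \<notin> Z" using W(1) unfolding W_def Z_def by blast+
  then have "Z \<noteq> V" by blast
  ultimately have "Z = {}" using cut_ge3(1)[of Z] unfolding Z_def by fastforce
  then have V: "V = W \<union> S \<union> T" using W S T unfolding Z_def by blast
  have "es g \<in> es ` H \<or> (\<exists>t\<in>T. \<exists>x\<in>S \<union> W. es g = {t, x})" if g: "g \<in> E" for g
  proof (cases "\<exists>t\<in>T. t \<in> es g")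
    case True
    then show ?thesis using T_edge[OF g] by blast
  next
    case False
    then have "es g \<subseteq> S \<union> W" using es_V[OF g] unfolding V by blast
    then have "g \<in> H" using g inH unfolding edges_inside_def by blast
    then show ?thesis by blast
  qed
  then have "\<forall>g\<in>E. es g \<in> {{a, b}, {b, c}, {c, d}, {d, e}, {e, f}, {f, a}} \<or>
      (\<exists>t\<in>T. \<exists>x\<in>S \<union> W. es g = {t, x})" unfolding H(3) by (rule ballI)
  moreover have "S \<inter> W = {}" "T \<inter> W = {}" "S \<inter> T = {}" using S T by blast+
  ultimately have "bipartite_outside a b c d e f S T"
    using hex V cardT unfolding bipartite_outside_def W_def by (intro conjI)
  then show ?thesis by blast
qed

text \<open>Two edges at \<open>a\<close> are hexagon sides and the third is parallel to neither, so
  it must go to \<open>T\<close>. Uniqueness is kept because removing this edge has to remove every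
  edge from \<open>a\<close> to \<open>T\<close>.\<close>

lemma third_edge:
  assumes "bipartite_outside a b c d e f S T"
  obtains g t where "g \<in> E" "t \<in> T" "es g = {a, t}"
    "\<And>k u. k \<in> E \<Longrightarrow> u \<in> T \<Longrightarrow> es k = {a, u} \<Longrightarrow> k = g"
proof -
  note hex = bipartite_outsideD(1)[OF assms] and dT = bipartite_outsideD(4)[OF assms]
    and cl = bipartite_outsideD(7)[OF assms]
  note V = hexagon_V[OF hex]
  have dist: "distinct [a, b, c, d, e, f]" using hex unfolding hexagon_def by blast
  obtain h1 h2 where h: "h1 \<in> E" "es h1 = {a, b}" "h2 \<in> E" "es h2 = {f, a}"
    using hex unfolding hexagon_def adj_iff_endset by blast
  let ?I = "{g\<in>E. a \<in> es g}"
  have "h1 \<noteq> h2" using h dist by (auto simp: doubleton_eq_iff)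
  moreover have "h1 \<in> ?I" "h2 \<in> ?I" using h by auto
  moreover have card3: "card ?I = 3" using card_inc[of a] V(1) by simp
  ultimately have "card (?I - {h1, h2}) = 1" by (subst card_Diff_subset) auto
  then obtain g where g: "?I - {h1, h2} = {g}" by (auto simp: card_1_singleton_iff)
  have gI: "g \<in> E" "a \<in> es g" "g \<noteq> h1" "g \<noteq> h2" using g by blast+
  have "es g \<noteq> {a, b}" "es g \<noteq> {f, a}" using no_digon[OF V(3) gI(1)] h gI by metis+
  then have "es g \<notin> {{a, b}, {b, c}, {c, d}, {d, e}, {e, f}, {f, a}}"
    using gI(2) dist by auto
  then have "\<exists>t\<in>T. \<exists>x\<in>S \<union> {a, b, c, d, e, f}. es g = {t, x}"
    using cl[OF gI(1)] by (simp only: simp_thms)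
  then obtain t x where t: "t \<in> T" "es g = {t, x}" by blast
  have "a \<noteq> t" using dT t(1) by blast
  then have "es g = {a, t}" using gI(2) t(2) by auto
  moreover have "k = g" if k: "k \<in> E" "u \<in> T" "es k = {a, u}" for k u
  proof -
    have "u \<noteq> b" "u \<noteq> f" "u \<noteq> a" using dT k(2) by blast+
    then have "k \<noteq> h1" "k \<noteq> h2" using k(3) h by (auto simp: doubleton_eq_iff)
    then have "k \<in> ?I - {h1, h2}" using k by simp
    then show ?thesis using g by simp
  qed
  ultimately show thesis using that gI(1) t(1) by blast
qed

lemma outside_edge:
  assumes bo: "bipartite_outside a b c d e f S T" and g: "g \<in> E" "s \<in> es g" "s \<in> S"
  shows "\<exists>t\<in>T. es g = {s, t}"
proof -
  note D = bipartite_outsideD[OF bo]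
  have "s \<notin> {a, b, c, d, e, f}" using D(3) g(3) by blast
  then have "es g \<notin> {{a, b}, {b, c}, {c, d}, {d, e}, {e, f}, {f, a}}" using g(2) by auto
  then have "\<exists>t\<in>T. \<exists>x\<in>S \<union> {a, b, c, d, e, f}. es g = {t, x}"
    using D(7)[OF g(1)] by (simp only: simp_thms)
  then obtain t x where t: "t \<in> T" "es g = {t, x}" by blast
  have "s \<noteq> t" using t(1) g(3) D(5) by blast
  then show ?thesis using t g(2) by auto
qed

end

section \<open>Antipodal vertices and the Petersen graph\<close>

text \<open>A certificate: vertices and edges listed in the order of the standard numbering. The
  isomorphism is the inverse of list indexing, and comparing end sets absorbs edge
  orientation.\<close>

lemma is_petersenI:
  assumes V: "distinct vs" "length vs = 10" "set vs = V" and E: "distinct gs" "length gs = 15" "set gs = E"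
    and ends: "map (endset ends) gs = map (\<lambda>i. {vs ! fst (petersen_ends i), vs ! snd (petersen_ends i)}) [0..<15]"
  shows "is_petersen V E ends"
proof -
  have bv: "bij_betw ((!) vs) {0..<10} V" and bg: "bij_betw ((!) gs) {0..<15} E"
    using V E by (auto intro!: bij_betw_nth simp: atLeast0LessThan)
  define f where "f = inv_into {0..<10} ((!) vs)"
  define g where "g = inv_into {0..<15} ((!) gs)"
  have f: "bij_betw f V {0..<10}" and g: "bij_betw g E {0..<15}"
    unfolding f_def g_def using bij_betw_inv_into[OF bv] bij_betw_inv_into[OF bg] by auto
  have f_nth: "f (vs ! i) = i" if "i < 10" for i
    unfolding f_def using bij_betw_inv_into_left[OF bv, of i] that by simp
  have "petersen_ends (g e) = (f (fst (ends e)), f (snd (ends e))) \<or>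
      petersen_ends (g e) = (f (snd (ends e)), f (fst (ends e)))" if e: "e \<in> E" for e
  proof -
    define i where "i = g e"
    have i: "i < 15" using bij_betw_apply[OF g e] unfolding i_def by simp
    have ei: "gs ! i = e" unfolding i_def g_def using bij_betw_inv_into_right[OF bg e] .
    obtain x y where xy: "petersen_ends i = (x, y)" by fastforce
    have lt: "x < 10" "y < 10" using xy i unfolding petersen_ends_def by (auto split: if_splits)
    have "map (endset ends) gs ! i = {vs ! x, vs ! y}" unfolding ends using i xy by simp
    then have "{fst (ends e), snd (ends e)} = {vs ! x, vs ! y}" using i E(2) ei unfolding endset_def by simp
    then have "(fst (ends e) = vs ! x \<and> snd (ends e) = vs ! y) \<or> (fst (ends e) = vs ! y \<and> snd (ends e) = vs ! x)"
      by (simp add: doubleton_eq_iff)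
    then show ?thesis using xy f_nth lt unfolding i_def[symmetric] by auto
  qed
  then show ?thesis unfolding is_petersen_def graph_iso_def using f g by blast
qed

context c4c_cubic
begin

text \<open>All 3|X| edges at \<open>X\<close> lie inside \<open>X \<union> N\<close>, so at most
  3(|N| - |X|) edges leave this set. It has at least two vertices and misses the hexagon, so its cut
  has at least four edges, and |N| - |X| is at least 2.\<close>

lemma nbrs_surplus:
  assumes bo: "bipartite_outside a b c d e f S T" and X: "X \<subseteq> S" "X \<noteq> {}"
  shows "card X + 2 \<le> card {u\<in>T. \<exists>s\<in>X. adj E ends s u}"
proof -
  note D = bipartite_outsideD[OF bo]
  note hex = hexagon_V[OF D(1)]
  define N where "N = {u\<in>T. \<exists>s\<in>X. adj E ends s u}"
  let ?Y = "X \<union> N"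
  have XV: "X \<subseteq> V" and NV: "N \<subseteq> V" using X D(2) unfolding N_def by blast+
  have fin: "finite X" "finite N" using XV NV finV finite_subset by blast+
  have XN: "X \<inter> N = {}" using X D(5) unfolding N_def by blast
  note S_edge = outside_edge[OF bo]
  have "inside X = {}"
  proof (rule equals0I)
    fix g assume "g \<in> inside X"
    then have g: "g \<in> E" "es g \<subseteq> X" unfolding edges_inside_def by auto
    then obtain s where s: "s \<in> es g" by (metis endset_nonempty ex_in_conv)
    then obtain t where "t \<in> T" "es g = {s, t}" using S_edge[OF g(1) s] g(2) X(1) by blast
    then show False using g(2) X(1) D(5) by blast
  qed
  then have cX: "card (\<delta> X) = 3 * card X" using cut_count[OF XV] by simp
  have "\<delta> X \<subseteq> inside ?Y"
  proof
    fix g assume "g \<in> \<delta> X"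
    then have g: "g \<in> E" "\<exists>s\<in>X. s \<in> es g" unfolding edge_cut_def endset_def by auto
    then obtain s where s: "s \<in> X" "s \<in> es g" by blast
    then obtain t where t: "t \<in> T" "es g = {s, t}" using S_edge[OF g(1) s(2)] X(1) by blast
    then have "t \<in> N" using s(1) g(1) unfolding N_def adj_iff_endset by blast
    then show "g \<in> inside ?Y" using g(1) s(1) t(2) unfolding edges_inside_def by simp
  qed
  then have le: "3 * card X \<le> card (inside ?Y)" using card_mono[OF finite_inside] cX by metis
  have cY: "card ?Y = card X + card N" using fin XN by (rule card_Un_disjoint)
  have count: "3 * card X + 3 * card N = card (\<delta> ?Y) + 2 * card (inside ?Y)"
    using cut_count[of ?Y] XV NV cY by simp
  have "{a, b, c, d, e, f} \<subseteq> V - ?Y" using hex(1) X(1) D(3,4) unfolding N_def by blast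
  then have outer: "6 \<le> card (V - ?Y)" using hex(2) finV by (metis card_mono finite_Diff)
  have Y: "?Y \<subseteq> V" "?Y \<noteq> {}" using XV NV X(2) by blast+
  have YV: "?Y \<noteq> V" using outer by auto
  have "3 \<le> card (\<delta> ?Y)" using cut_ge3(1)[OF Y YV] .
  moreover have "card X > 0" using X(2) fin by (simp add: card_gt_0_iff)
  \<comment> \<open>A cut of at least three edges already gives |N| > |X|; this first step is what
    rules out a trivial cut.\<close>
  ultimately have "2 \<le> card ?Y" using count le cY by linarith
  then have "card (\<delta> ?Y) \<noteq> 3" using cut_ge3(2)[OF Y YV] outer by auto
  then have "card X + 2 \<le> card N" using \<open>3 \<le> card (\<delta> ?Y)\<close> count le by linarith
  then show ?thesis unfolding N_def .
qed

text \<open>The surplus of two survives the loss of \<open>t\<close> and \<open>t'\<close>, and |T|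
  = |S| + 2 makes the resulting injection onto.\<close>

lemma outside_matching:
  assumes bo: "bipartite_outside a b c d e f S T" and t: "t \<in> T" "t' \<in> T" "t \<noteq> t'"
  shows "\<exists>M. matches M (S \<union> (T - {t, t'}))"
proof -
  note D = bipartite_outsideD[OF bo]
  have fin: "finite S" "finite T" using finV D(2) by (metis finite_Un)+
  define nb where "nb s = {u\<in>T - {t, t'}. adj E ends s u}" for s
  have "\<exists>h. inj_on h S \<and> (\<forall>s\<in>S. h s \<in> nb s)"
  proof (rule hall_marriage[OF fin(1)])
    show "finite (nb s)" for s using fin(2) unfolding nb_def by simp
    fix X assume X: "X \<subseteq> S"
    show "card X \<le> card (\<Union>(nb ` X))"
    proof (cases "X = {}")
      case False
      define N where "N = {u\<in>T. \<exists>s\<in>X. adj E ends s u}"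
      have "card X + 2 \<le> card N" unfolding N_def by (rule nbrs_surplus[OF bo X False])
      moreover have "card N - card {t, t'} \<le> card (N - {t, t'})" by (rule diff_card_le_card_Diff) simp
      moreover have "\<Union>(nb ` X) = N - {t, t'}" unfolding nb_def N_def by blast
      ultimately show ?thesis using t(3) by simp
    qed simp
  qed
  then obtain h where h: "inj_on h S" "\<forall>s\<in>S. h s \<in> nb s" by blast
  have "h ` S \<subseteq> T - {t, t'}" using h(2) unfolding nb_def by blast
  moreover have "card (T - {t, t'}) = card S" using t fin D(6) by (subst card_Diff_subset) auto
  ultimately have hS: "h ` S = T - {t, t'}" using h(1) fin(2) by (intro card_subset_eq) (auto simp: card_image)
  have "S \<inter> h ` S = {}" using hS D(5) by blast
  then have "\<exists>N. pairing (adj E ends) (S \<union> h ` S) N"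
    using h by (intro pairing_inj) (auto simp: nb_def)
  then show ?thesis using pairing_matches unfolding hS by blast
qed

text \<open>Otherwise \<open>M\<close>, built from \<open>at\<close>, \<open>dt'\<close>,
  \<open>bc\<close>, \<open>ef\<close> and a matching outside, deletes exactly the edges that
  obstruct a bipartition with \<open>a\<close> and \<open>d\<close> on the side of \<open>T\<close>.
  The 2-regular rest then splits into two perfect matchings.\<close>

lemma antipodal_neighbours:
  assumes bo: "bipartite_outside a b c d e f S T"
    and g: "g \<in> E" "es g = {a, t}" "t \<in> T" and g': "g' \<in> E" "es g' = {d, t'}" "t' \<in> T"
    and no3: "\<nexists>M1 M2 M3. perfect_matching V E ends M1 \<and> perfect_matching V E ends M2 \<and>
       perfect_matching V E ends M3 \<and> E \<subseteq> M1 \<union> M2 \<union> M3"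
  shows "t = t'"
proof (rule ccontr)
  assume tt: "t \<noteq> t'"
  note D = bipartite_outsideD[OF bo]
  note hex = hexagon_V[OF D(1)]
  have dist: "distinct [a, b, c, d, e, f]" using D(1) unfolding hexagon_def by blast
  have tW: "t \<notin> {a, b, c, d, e, f}" "t' \<notin> {a, b, c, d, e, f}" using D(4) g(3) g'(3) by blast+
  obtain h h' where h: "h \<in> E" "es h = {b, c}" "h' \<in> E" "es h' = {e, f}"
    using D(1) unfolding hexagon_def adj_iff_endset by blast
  obtain MB where MB: "matches MB (S \<union> (T - {t, t'}))" using outside_matching[OF bo g(3) g'(3) tt] by blast
  define M where "M = ({g} \<union> {g'}) \<union> ({h} \<union> {h'}) \<union> MB"
  have "matches ({g} \<union> {g'}) ({a, t} \<union> {d, t'})"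
    using g g' tt tW dist by (intro matches_Un matches_single) auto
  moreover have "matches ({h} \<union> {h'}) ({b, c} \<union> {e, f})"
    using h dist by (intro matches_Un matches_single) auto
  moreover have "({a, t} \<union> {d, t'}) \<inter> ({b, c} \<union> {e, f}) = {}" using tW dist by auto
  ultimately have "matches (({g} \<union> {g'}) \<union> ({h} \<union> {h'})) (({a, t} \<union> {d, t'}) \<union> ({b, c} \<union> {e, f}))"
    by (rule matches_Un)
  moreover have "(({a, t} \<union> {d, t'}) \<union> ({b, c} \<union> {e, f})) \<inter> (S \<union> (T - {t, t'})) = {}"
    using D(3,4,5) g(3) g'(3) by auto
  ultimately have "matches M ((({a, t} \<union> {d, t'}) \<union> ({b, c} \<union> {e, f})) \<union> (S \<union> (T - {t, t'})))"
    unfolding M_def using MB matches_Un by metis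
  moreover have "(({a, t} \<union> {d, t'}) \<union> ({b, c} \<union> {e, f})) \<union> (S \<union> (T - {t, t'})) = V"
    using D(2) g(3) g'(3) by auto
  ultimately have M: "perfect_matching V E ends M" using matches_V by simp
  then have ME: "M \<subseteq> E" unfolding perfect_matching_def by blast
  have fin: "finite S" "finite T" "finite M" using finV D(2) ME finE by (metis finite_Un finite_subset)+
  \<comment> \<open>The surviving hexagon sides \<open>ab\<close>, \<open>cd\<close>,
    \<open>de\<close>, \<open>fa\<close> each join {a, d} to {b, c, e, f}.\<close>
  let ?P = "T \<union> {a, d}" and ?Q = "S \<union> {b, c, e, f}"
  have PQ: "?P \<union> ?Q = V" using D(2) by auto
  have deg_split: "deg_in F' ends v + deg_in (F - F') ends v = deg_in F ends v"
    if "F' \<subseteq> F" "F \<subseteq> E" for F F' v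
    using deg_in_Un[of F' "F - F'" ends v] that finE by (metis Diff_disjoint Un_Diff_cancel finite_Diff finite_subset sup.absorb2)
  have deg2: "deg_in (E - M) ends v = 2" if "v \<in> V" for v
    using deg_split[OF ME, of v] deg3[OF that] M that unfolding perfect_matching_def by simp
  have bip: "\<exists>p\<in>?P. \<exists>q\<in>?Q. es k = {p, q}" if k: "k \<in> E - M" for k
  proof -
    have kE: "k \<in> E" and kM: "k \<noteq> g" "k \<noteq> g'" "k \<noteq> h" "k \<noteq> h'" using k unfolding M_def by blast+
    have bc: "es k \<noteq> {b, c}" "es k \<noteq> {e, f}" using no_digon[OF hex(3) kE] h kM by metis+
    \<comment> \<open>Edges from \<open>a\<close> or \<open>d\<close> to \<open>T\<close> would stay
      within one class; each vertex has only one, and \<open>M\<close> contains it. Three rotations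
      bring \<open>d\<close> to the position of \<open>a\<close>.\<close>
    have ad: "es k \<noteq> {u, a}" "es k \<noteq> {u, d}" if u: "u \<in> T" for u
    proof -
      obtain ga where "\<And>k u. k \<in> E \<Longrightarrow> u \<in> T \<Longrightarrow> es k = {a, u} \<Longrightarrow> k = ga"
        using third_edge[OF bo] by metis
      then show "es k \<noteq> {u, a}" using kE u g kM(1) by (metis insert_commute)
      obtain gd where "\<And>k u. k \<in> E \<Longrightarrow> u \<in> T \<Longrightarrow> es k = {d, u} \<Longrightarrow> k = gd"
        using third_edge[OF bipartite_outside_rotate[OF bipartite_outside_rotate[OF bipartite_outside_rotate[OF bo]]]]
        by metis
      then show "es k \<noteq> {u, d}" using kE u g' kM(2) by (metis insert_commute)
    qed
    from D(7)[OF kE] show ?thesis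
    proof
      assume "es k \<in> {{a, b}, {b, c}, {c, d}, {d, e}, {e, f}, {f, a}}"
      then consider "es k = {a, b}" | "es k = {d, c}" | "es k = {d, e}" | "es k = {a, f}"
        using bc by (auto simp: insert_commute)
      then show ?thesis by cases blast+
    next
      assume "\<exists>u\<in>T. \<exists>x\<in>S \<union> {a, b, c, d, e, f}. es k = {u, x}"
      then obtain u x where u: "u \<in> T" "x \<in> S \<union> {a, b, c, d, e, f}" "es k = {u, x}" by blast
      then have "x \<noteq> a" "x \<noteq> d" using ad by blast+
      then have "x \<in> ?Q" using u(2) by blast
      moreover have "u \<in> ?P" using u(1) by blast
      ultimately show ?thesis using u(3) by (intro bexI[of _ u] bexI[of _ x])
    qed
  qed
  have "\<exists>M'\<subseteq>E - M. \<forall>v\<in>?P \<union> ?Q. deg_in M' ends v = 1"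
  proof (rule regular_bipartite_matching)
    show "finite (E - M)" using finE by simp
    show "finite ?P" "finite ?Q" using fin by simp_all
    show "?P \<inter> ?Q = {}" using D(3,4,5) dist by auto
    show "(0::nat) < 2" by simp
    show "deg_in (E - M) ends v = 2" if "v \<in> ?P \<union> ?Q" for v using deg2 that unfolding PQ by blast
  qed (rule bip)
  then obtain M' where M': "M' \<subseteq> E - M" "\<forall>v\<in>V. deg_in M' ends v = 1" unfolding PQ by blast
  have "deg_in (E - M - M') ends v = 1" if "v \<in> V" for v
    using deg_split[OF M'(1), of v] deg2[OF that] M'(2) that by simp
  then have "perfect_matching V E ends M'" "perfect_matching V E ends (E - M - M')"
    using M' unfolding perfect_matching_def by blast+
  moreover have "E \<subseteq> M \<union> M' \<union> (E - M - M')" by blast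
  ultimately show False using no3 M by blast
qed

text \<open>Degree 3 keeps \<open>p\<close>, \<open>q\<close>, \<open>r\<close> apart. The cut
  around the hexagon and these three is then so small that one vertex \<open>s\<close> remains, and
  its three edges can only go to \<open>p\<close>, \<open>q\<close>, \<open>r\<close>.\<close>

lemma petersen_if_antipodal:
  assumes bo: "bipartite_outside a b c d e f S T" and T: "p \<in> T" "q \<in> T" "r \<in> T"
    and gE: "{ga, gb, gc, gd, ge, gf} \<subseteq> E"
    and g: "es ga = {a, p}" "es gd = {d, p}" "es gb = {b, q}" "es ge = {e, q}" "es gc = {c, r}" "es gf = {f, r}"
  shows "is_petersen V E ends"
proof -
  note D = bipartite_outsideD[OF bo]
  note hex = hexagon_V[OF D(1)]
  have dist: "distinct [a, b, c, d, e, f]" using D(1) unfolding hexagon_def by blast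
  have TV: "T \<subseteq> V" using D(2) by blast
  have notW: "p \<notin> {a, b, c, d, e, f}" "q \<notin> {a, b, c, d, e, f}" "r \<notin> {a, b, c, d, e, f}" using D(4) T by blast+
  have four: False if k: "{k1, k2, k3, k4} \<subseteq> {g\<in>E. u \<in> es g}" "distinct (map es [k1, k2, k3, k4])" "u \<in> T"
    for k1 k2 k3 k4 u
  proof -
    have "distinct [k1, k2, k3, k4]" using k(2) unfolding distinct_map by blast
    then have "card {k1, k2, k3, k4} = 4" using distinct_card[of "[k1, k2, k3, k4]"] by simp
    moreover have "card {k1, k2, k3, k4} \<le> 3"
      using card_mono[OF _ k(1)] card_inc[of u] k(3) TV finE by auto
    ultimately show False by simp
  qed
  have "p \<noteq> q"
  proof
    assume "p = q"
    then show False using four[of ga gd gb ge p] gE g dist notW T by (auto simp: doubleton_eq_iff)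
  qed
  moreover have "p \<noteq> r"
  proof
    assume "p = r"
    then show False using four[of ga gd gc gf p] gE g dist notW T by (auto simp: doubleton_eq_iff)
  qed
  moreover have "q \<noteq> r"
  proof
    assume "q = r"
    then show False using four[of gb ge gc gf q] gE g dist notW T by (auto simp: doubleton_eq_iff)
  qed
  ultimately have dist9: "distinct [a, b, c, d, e, f, p, q, r]" using dist notW by auto
  obtain hab hbc hcd hde hef hfa where h: "es hab = {a, b}" "es hbc = {b, c}" "es hcd = {c, d}"
    "es hde = {d, e}" "es hef = {e, f}" "es hfa = {f, a}" and hE: "{hab, hbc, hcd, hde, hef, hfa} \<subseteq> E"
    using D(1) unfolding hexagon_def adj_iff_endset by (metis (no_types, lifting) empty_subsetI insert_subset)
  let ?Y = "set [a, b, c, d, e, f, p, q, r]"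
  let ?L = "[ga, gb, gc, gd, ge, gf, hab, hbc, hcd, hde, hef, hfa]"
  have YV: "?Y \<subseteq> V" using hex(1) T TV by auto
  have cY: "card ?Y = 9" using distinct_card[OF dist9] by simp
  have dL: "distinct (map es ?L)" using dist9 by (auto simp: g h doubleton_eq_iff)
  then have "distinct ?L" unfolding distinct_map by blast
  then have "card (set ?L) = 12" using distinct_card[of ?L] by simp
  moreover have "set ?L \<subseteq> inside ?Y" using gE hE by (auto simp: edges_inside_def g h)
  ultimately have "12 \<le> card (inside ?Y)" using card_mono[OF finite_inside] by metis
  then have cut: "card (\<delta> ?Y) \<le> 3" using cut_count[OF YV] cY by simp
  \<comment> \<open>Nine is odd, so \<open>V\<close> is larger, and the 3-cut around
    \<open>?Y\<close> must isolate a vertex on the other side.\<close>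
  have "?Y \<noteq> V" using even_card_V cY by (metis odd_numeral)
  moreover have "?Y \<noteq> {}" by simp
  ultimately have "card (V - ?Y) = 1" using cut_ge3[OF YV] cut cY by (metis le_antisym numeral_eq_one_iff semiring_norm(86))
  then obtain s where s: "V - ?Y = {s}" by (auto simp: card_1_singleton_iff)
  have V: "V = insert s ?Y" "s \<notin> ?Y" using s YV by blast+
  have cV: "card V = 10" unfolding V(1) using V(2) cY by simp
  have cE: "card E = 15" using edge_count cV by simp
  have finT: "finite T" using TV finV finite_subset by blast
  \<comment> \<open>Three vertices in \<open>T\<close> force \<open>S\<close> to be nonempty, and
    \<open>s\<close> is the only vertex left for it.\<close>
  have "card {p, q, r} = 3" using dist9 by simp
  then have "3 \<le> card T" using card_mono[OF finT, of "{p, q, r}"] T by simp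
  then have "card S > 0" using D(6) by simp
  then obtain x where x: "x \<in> S" by (metis card.empty ex_in_conv less_irrefl)
  have "S \<inter> ?Y = {}" using D(3,5) T by auto
  then have "x = s" using x D(2) V(1) by blast
  then have sS: "s \<in> S" using x by simp
  have Tpqr: "T \<subseteq> {p, q, r}"
  proof
    fix t assume "t \<in> T"
    then have "t \<in> V" "t \<notin> {a, b, c, d, e, f}" "t \<noteq> s" using TV D(4,5) sS by blast+
    then show "t \<in> {p, q, r}" using V(1) by auto
  qed
  let ?I = "{g\<in>E. s \<in> es g}"
  have "es ` ?I \<subseteq> {{s, p}, {s, q}, {s, r}}"
  proof
    fix z assume "z \<in> es ` ?I"
    then obtain k where k: "k \<in> E" "s \<in> es k" "z = es k" by blast
    then obtain t where "t \<in> T" "es k = {s, t}" using outside_edge[OF bo k(1,2) sS] by blast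
    then show "z \<in> {{s, p}, {s, q}, {s, r}}" using Tpqr k(3) by auto
  qed
  moreover have "inj_on es ?I" using no_digon[OF hex(3)] by (auto intro: inj_onI)
  then have "card (es ` ?I) = 3" using card_inc[of s] V(1) by (simp add: card_image)
  moreover have "card {{s, p}, {s, q}, {s, r}} = 3" using dist9 V(2) by (auto simp: doubleton_eq_iff)
  ultimately have "es ` ?I = {{s, p}, {s, q}, {s, r}}" by (intro card_subset_eq) auto
  then have "{s, p} \<in> es ` ?I" "{s, q} \<in> es ` ?I" "{s, r} \<in> es ` ?I" by simp_all
  then obtain kp kq kr where k: "es kp = {s, p}" "es kq = {s, q}" "es kr = {s, r}" and kE: "{kp, kq, kr} \<subseteq> E"
    by (elim imageE) auto
  \<comment> \<open>The outer pentagon is the 5-cycle \<open>s p a b q\<close>; the remaining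
    neighbours \<open>r\<close>, \<open>d\<close>, \<open>f\<close>, \<open>c\<close>,
    \<open>e\<close> along the spokes then form the pentagram. \<open>?gs\<close> lists the edges in
    the order of \<open>petersen_ends\<close>.\<close>
  let ?vs = "[s, p, a, b, q, r, d, f, c, e]"
  let ?gs = "[kp, ga, hab, gb, kq, kr, gd, hfa, hbc, ge, gf, hcd, hef, gc, hde]"
  have dvs: "distinct ?vs" using dist9 V(2) by auto
  have "distinct (map es ?gs)" using dvs by (auto simp: g h k doubleton_eq_iff)
  then have dgs: "distinct ?gs" unfolding distinct_map by blast
  have "set ?gs \<subseteq> E" using gE hE kE by auto
  moreover have "card (set ?gs) = 15" using distinct_card[OF dgs] by simp
  ultimately have gs: "set ?gs = E" using cE finE by (intro card_subset_eq) auto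
  show ?thesis
  proof (rule is_petersenI[OF dvs _ _ dgs _ gs])
    show "set ?vs = V" using V(1) by auto
    have upt: "[0..<15] = [0, 1, 2, 3, 4, 5, 6, 7, 8, 9, 10, 11, 12, 13, 14::nat]"
      by (simp add: upt_rec)
    show "map es ?gs = map (\<lambda>i. {?vs ! fst (petersen_ends i), ?vs ! snd (petersen_ends i)}) [0..<15]"
      unfolding upt by (simp add: g h k petersen_ends_def insert_commute)
  qed simp_all
qed

end

section \<open>Assembling the cover by four perfect matchings\<close>

theorem theorem1p2:
  fixes V :: "'v set" and E :: "'e set" and ends :: "'e \<Rightarrow> 'v \<times> 'v"
  assumes "cubic V E ends"
    and "bridgeless V E ends"
    and "cyc_edge_conn 4 V E ends"
    and "colouring_defect V E ends = 3"
    and "\<not> is_petersen V E ends"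
  shows "pm_index V E ends = 4"
proof -
  interpret c4c_cubic V E ends using assms(1,3) by unfold_locales
  let ?PM = "perfect_matching V E ends"
  let ?Q = "\<lambda>n. \<exists>M1 M2 M3. ?PM M1 \<and> ?PM M2 \<and> ?PM M3 \<and> card (E - (M1 \<union> M2 \<union> M3)) = n"
  have least: "(LEAST n. ?Q n) = 3" using assms(4) unfolding colouring_defect_def .
  have no3: "\<not> E \<subseteq> M1 \<union> M2 \<union> M3" if "?PM M1" "?PM M2" "?PM M3" for M1 M2 M3
  proof
    assume "E \<subseteq> M1 \<union> M2 \<union> M3"
    then have "card (E - (M1 \<union> M2 \<union> M3)) = 0" by (simp add: Diff_eq_empty_iff[THEN iffD2])
    then have "?Q 0" using that by blast
    then have "(LEAST n. ?Q n) \<le> 0" by (rule Least_le)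
    then show False using least by simp
  qed
  have "\<exists>n. ?Q n" using perfect_matching_exists by blast
  from LeastI_ex[OF this] obtain M1 M2 M3 where M: "?PM M1" "?PM M2" "?PM M3"
    and card_U: "card (E - (M1 \<union> M2 \<union> M3)) = 3" unfolding least by blast
  define U where "U = E - (M1 \<union> M2 \<union> M3)"
  have "card U = 3" using card_U unfolding U_def .
  obtain a b c d e f where hex: "hexagon a b c d e f"
    and U_deg: "\<forall>v\<in>{a, b, c, d, e, f}. deg_in U ends v = 1"
    and U_in: "\<forall>g\<in>U. es g \<subseteq> {a, b, c, d, e, f}"
    using core_hexagon[OF M U_def \<open>card U = 3\<close>] .
  have "\<exists>N. matches N (V - {a, b, c, d, e, f})"
  proof (rule ccontr)
    assume "\<nexists>N. matches N (V - {a, b, c, d, e, f})"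
    then obtain S T where bo: "bipartite_outside a b c d e f S T"
      using bipartite_outside_if_no_matching[OF hex] by blast
    note bo1 = bipartite_outside_rotate[OF bo]
    note bo2 = bipartite_outside_rotate[OF bo1]
    note bo3 = bipartite_outside_rotate[OF bo2]
    note bo4 = bipartite_outside_rotate[OF bo3]
    note bo5 = bipartite_outside_rotate[OF bo4]
    obtain ga ta where a: "ga \<in> E" "es ga = {a, ta}" "ta \<in> T" using third_edge[OF bo] by metis
    obtain gb tb where b: "gb \<in> E" "es gb = {b, tb}" "tb \<in> T" using third_edge[OF bo1] by metis
    obtain gc tc where c: "gc \<in> E" "es gc = {c, tc}" "tc \<in> T" using third_edge[OF bo2] by metis
    obtain gd td where d: "gd \<in> E" "es gd = {d, td}" "td \<in> T" using third_edge[OF bo3] by metis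
    obtain ge te where e: "ge \<in> E" "es ge = {e, te}" "te \<in> T" using third_edge[OF bo4] by metis
    obtain gf tf where f: "gf \<in> E" "es gf = {f, tf}" "tf \<in> T" using third_edge[OF bo5] by metis
    have "\<nexists>M1 M2 M3. ?PM M1 \<and> ?PM M2 \<and> ?PM M3 \<and> E \<subseteq> M1 \<union> M2 \<union> M3" using no3 by blast
    then have "ta = td" "tb = te" "tc = tf"
      using antipodal_neighbours[OF bo a d] antipodal_neighbours[OF bo1 b e]
        antipodal_neighbours[OF bo2 c f] by blast+
    then have "is_petersen V E ends"
      using a b c d e f by (intro petersen_if_antipodal[OF bo a(3) b(3) c(3), of ga gb gc gd ge gf]) auto
    then show False using assms(5) by contradiction
  qed
  then obtain N where N: "matches N (V - {a, b, c, d, e, f})" by blast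
  \<comment> \<open>\<open>U\<close> consists of three alternate hexagon sides, so it matches the
    hexagon itself.\<close>
  have "matches U {a, b, c, d, e, f}" using U_deg U_in unfolding matches_def U_def by blast
  from matches_Un[OF this N] have "matches (U \<union> N) V"
    using hexagon_V(1)[OF hex] by (simp add: Un_absorb1 insert_absorb)
  then have M4: "?PM (U \<union> N)" unfolding matches_V .
  show ?thesis
    unfolding pm_index_def
  proof (rule Least_equality)
    have "E \<subseteq> \<Union>(set [M1, M2, M3, U \<union> N])" unfolding U_def by auto
    then show "\<exists>Ms. length Ms = 4 \<and> (\<forall>M\<in>set Ms. ?PM M) \<and> E \<subseteq> \<Union>(set Ms)"
      using M M4 by (intro exI[of _ "[M1, M2, M3, U \<union> N]"]) simp
  next
    fix k assume "\<exists>Ms. length Ms = k \<and> (\<forall>M\<in>set Ms. ?PM M) \<and> E \<subseteq> \<Union>(set Ms)"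
    then obtain Ms where Ms: "length Ms = k" "\<forall>M\<in>set Ms. ?PM M" "E \<subseteq> \<Union>(set Ms)" by blast
    show "4 \<le> k"
    proof (rule ccontr)
      assume "\<not> 4 \<le> k"
      \<comment> \<open>Shorter lists are padded by repetition, since the three matchings in the
        defect need not be distinct.\<close>
      then have "length Ms = 0 \<or> length Ms = 1 \<or> length Ms = 2 \<or> length Ms = 3" using Ms(1) by linarith
      then consider "Ms = []" | A where "Ms = [A]" | A B where "Ms = [A, B]" | A B C where "Ms = [A, B, C]"
        by (auto simp: length_Suc_conv numeral_2_eq_2 numeral_3_eq_3)
      then show False
      proof cases
        case 1
        then show False using Ms(3) no3[OF M] by simp
      next
        case 2
        then show False using Ms(2,3) no3[of A A A] by simp
      next
        case 3
        then show False using Ms(2,3) no3[of A B B] by simp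
      next
        case 4
        then show False using Ms(2,3) no3[of A B C] by (simp add: Un_assoc)
      qed
    qed
  qed
qed

end
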